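(* Let $H$ be a real separable Hilbert space, $T\in(0,\infty)$, and let $A\colon\mathsf D(A)\subseteq H\to H$ be a linear operator such that $-A$ generates a $C_0$-semigroup $(S(t))_{t\ge0}$ on $H$. Let $\gamma\in(0,\infty)$ be such that there exists $\delta\in[0,\gamma)$ with $$\int_0^T\bigl\|t^{\gamma-1-\delta}S(t)Q^{\frac12}\bigr\|_{\mathscr L_2(H)}^2\,\mathrm dt<\infty.$$ Let $Z_\gamma$ be the mild solution to $(\partial_t+A)^\gamma X(t)=\dot W^Q(t)$, $t\in[0,T]$, $X(0)=0$. Then the covariance operators $(Q_{Z_\gamma}(s,t))_{s,t\in[0,T]}$ of $Z_\gamma$ admit the representation $$Q_{Z_\gamma}(s,t)=\frac1{\Gamma(\gamma)^2}\int_0^{s\wedge t}[(s-r)(t-r)]^{\gamma-1}S(t-r)\,Q\,[S(s-r)]^*\,\mathrm dr.$$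
   Context: $(\Omega,\mathcal F,\mathbb P)$ is a complete probability space with a normal filtration $(\mathcal F_t)_{t\ge0}$; $Q\in\mathscr L(H)$ is self-adjoint and strictly positive, i.e., there exists a constant $\theta\in(0,\infty)$ such that $(Qx,x)_H\ge\theta\|x\|_H^2$ for all $x\in H$; $(W^Q(t))_{t\ge0}$ is an $H$-valued cylindrical $Q$-Wiener process with respect to $(\mathcal F_t)_{t\ge0}$. $\mathscr L_2(H)$ denotes the Hilbert--Schmidt operators; $s\wedge t=\min\{s,t\}$. Mild solution: a predictable $H$-valued process $Z_\gamma$ such that for all $t\in[0,T]$, $Z_\gamma(t)=\frac1{\Gamma(\gamma)}\int_0^t(t-r)^{\gamma-1}S(t-r)\,\mathrm dW^Q(r)$, $\mathbb P$-a.s.; under the assumptions it exists, is unique up to modification, and is square-integrable. The covariance operators $Q_{Z_\gamma}(s,t)\in\mathscr L(H)$ are defined by $(Q_{Z_\gamma}(s,t)x,y)_H=\mathbb E\bigl[(Z_\gamma(s)-\mathbb E[Z_\gamma(s)],x)_H\,(Z_\gamma(t)-\mathbb E[Z_\gamma(t)],y)_H\bigr]$ for all $x,y\in H$. The operator-valued integral is understood in the strong sense (applied to each $x\in H$). *)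

theory Defs
  imports "HOL-Probability.Probability"
begin

section \<open>Operators on a real separable Hilbert space\<close>

text \<open>
  Real separable Hilbert spaces are types of sort
  \<open>{real_inner, banach, second_countable_topology}\<close>, and the bounded operators on such a
  space are \<open>'h \<Rightarrow>\<^sub>L 'h\<close>.  The adjoint of a bounded operator is the library's \<open>adjoint\<close>.
\<close>

definition self_adjoint_op :: "('h::real_inner \<Rightarrow>\<^sub>L 'h) \<Rightarrow> bool" where
  "self_adjoint_op Q \<longleftrightarrow> (\<forall>x y. Q x \<bullet> y = x \<bullet> Q y)"

definition strictly_positive_op :: "('h::real_inner \<Rightarrow>\<^sub>L 'h) \<Rightarrow> bool" where
  "strictly_positive_op Q \<longleftrightarrow> (\<exists>\<theta>>0. \<forall>x. Q x \<bullet> x \<ge> \<theta> * (norm x)\<^sup>2)"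

definition sqrt_op :: "('h::real_inner \<Rightarrow>\<^sub>L 'h) \<Rightarrow> ('h \<Rightarrow>\<^sub>L 'h)" where
  "sqrt_op Q = (THE R. self_adjoint_op R \<and> (\<forall>x. R x \<bullet> x \<ge> 0) \<and> R o\<^sub>L R = Q)"

definition orthonormal_basis :: "'h::real_inner set \<Rightarrow> bool" where
  "orthonormal_basis B \<longleftrightarrow>
     pairwise orthogonal B \<and> (\<forall>e\<in>B. norm e = 1) \<and> closure (span B) = UNIV"

text \<open>
  The squared Hilbert--Schmidt norm, with value \<open>\<infinity>\<close> exactly for the operators that are not
  Hilbert--Schmidt.  It does not depend on the orthonormal basis.
\<close>

definition hs_norm_sq :: "('h::real_inner \<Rightarrow>\<^sub>L 'h) \<Rightarrow> ennreal" where
  "hs_norm_sq K =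
     (\<integral>\<^sup>+ e. ennreal ((norm (K e))\<^sup>2) \<partial>count_space (SOME B. orthonormal_basis B))"

definition c0_semigroup :: "(real \<Rightarrow> ('h::real_normed_vector \<Rightarrow>\<^sub>L 'h)) \<Rightarrow> bool" where
  "c0_semigroup S \<longleftrightarrow>
     S 0 = id_blinfun \<and>
     (\<forall>s\<ge>0. \<forall>t\<ge>0. S (s + t) = S s o\<^sub>L S t) \<and>
     (\<forall>x. ((\<lambda>t. S t x) \<longlongrightarrow> x) (at_right 0))"

text \<open>An unbounded linear operator is given by its domain \<open>D\<close> and a function relevant only on \<open>D\<close>.\<close>

definition linear_op_on :: "'h::real_vector set \<Rightarrow> ('h \<Rightarrow> 'h) \<Rightarrow> bool" where
  "linear_op_on D A \<longleftrightarrow>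
     subspace D \<and> (\<forall>x\<in>D. \<forall>y\<in>D. A (x + y) = A x + A y) \<and> (\<forall>c. \<forall>x\<in>D. A (c *\<^sub>R x) = c *\<^sub>R A x)"

definition generates ::
  "'h::real_normed_vector set \<Rightarrow> ('h \<Rightarrow> 'h) \<Rightarrow> (real \<Rightarrow> ('h \<Rightarrow>\<^sub>L 'h)) \<Rightarrow> bool" where
  "generates D G S \<longleftrightarrow>
     D = {x. \<exists>y. ((\<lambda>h. (1 / h) *\<^sub>R (S h x - x)) \<longlongrightarrow> y) (at_right 0)} \<and>
     (\<forall>x\<in>D. ((\<lambda>h. (1 / h) *\<^sub>R (S h x - x)) \<longlongrightarrow> G x) (at_right 0))"

section \<open>Filtrations and cylindrical Wiener processes\<close>

text \<open>Only the values at times \<open>t \<ge> 0\<close> of filtrations and processes are relevant.\<close>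

definition normal_filtration :: "'w measure \<Rightarrow> (real \<Rightarrow> 'w measure) \<Rightarrow> bool" where
  "normal_filtration M F \<longleftrightarrow>
     (\<forall>t\<ge>0. subalgebra M (F t)) \<and>
     (\<forall>s\<ge>0. \<forall>t\<ge>s. sets (F s) \<subseteq> sets (F t)) \<and>
     (\<forall>t\<ge>0. sets (F t) = (\<Inter>s\<in>{t<..}. sets (F s))) \<and>
     null_sets M \<subseteq> sets (F 0)"

text \<open>The normal distribution \<open>N(0, v)\<close>; for \<open>v = 0\<close> it is the Dirac measure at \<open>0\<close>.\<close>

definition centered_normal :: "'w measure \<Rightarrow> real \<Rightarrow> ('w \<Rightarrow> real) \<Rightarrow> bool" where
  "centered_normal M v X \<longleftrightarrow>
     (if v = 0 then X \<in> borel_measurable M \<and> (AE \<omega> in M. X \<omega> = 0)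
      else v > 0 \<and> distributed M lborel X (normal_density 0 (sqrt v)))"

definition brownian_motion ::
  "'w measure \<Rightarrow> (real \<Rightarrow> 'w measure) \<Rightarrow> real \<Rightarrow> (real \<Rightarrow> 'w \<Rightarrow> real) \<Rightarrow> bool" where
  "brownian_motion M F v B \<longleftrightarrow>
     (\<forall>t\<ge>0. B t \<in> borel_measurable (F t)) \<and>
     (AE \<omega> in M. B 0 \<omega> = 0) \<and>
     (AE \<omega> in M. continuous_on {0..} (\<lambda>t. B t \<omega>)) \<and>
     (\<forall>s\<ge>0. \<forall>t>s.
        centered_normal M ((t - s) * v) (\<lambda>\<omega>. B t \<omega> - B s \<omega>) \<and>
        prob_space.indep_set M (sets (F s))
          (sets (vimage_algebra (space M) (\<lambda>\<omega>. B t \<omega> - B s \<omega>) borel)))"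

text \<open>
  A cylindrical \<open>Q\<close>-Wiener process need not take values in the Hilbert space.  It is given by the
  real random variables \<open>W t x\<close>, which stand for the formal pairings of \<open>W(t)\<close> with \<open>x\<close>.
  It follows that the covariance of \<open>W s x\<close> and \<open>W t y\<close> is
  \<open>min s t * (Q x \<bullet> y)\<close>, and the vectors \<open>(W t x\<^sub>i - W s x\<^sub>i)\<^sub>i\<close> are jointly Gaussian and
  independent of \<open>F s\<close>.
\<close>

definition cylindrical_wiener ::
  "'w measure \<Rightarrow> (real \<Rightarrow> 'w measure) \<Rightarrow> ('h::real_inner \<Rightarrow>\<^sub>L 'h) \<Rightarrow> (real \<Rightarrow> 'h \<Rightarrow> 'w \<Rightarrow> real) \<Rightarrow> bool"
where
  "cylindrical_wiener M F Q W \<longleftrightarrow>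
     (\<forall>x. brownian_motion M F (Q x \<bullet> x) (\<lambda>t. W t x)) \<and>
     (\<forall>t\<ge>0. \<forall>a b x y. AE \<omega> in M. W t (a *\<^sub>R x + b *\<^sub>R y) \<omega> = a * W t x \<omega> + b * W t y \<omega>)"

section \<open>Stochastic integration of deterministic operator-valued functions\<close>

text \<open>
  The list element \<open>(a, b, x, h)\<close> stands for the elementary integrand whose value is the rank-one
  operator \<open>u \<mapsto> (x \<bullet> u) *\<^sub>R h\<close> on \<open>(a, b]\<close> and \<open>0\<close> elsewhere; its stochastic integral is
  \<open>(W b x - W a x) *\<^sub>R h\<close>.
\<close>

type_synonym 'h elementary = "(real \<times> real \<times> 'h \<times> 'h) list"

definition elementary_on :: "real \<Rightarrow> 'h elementary \<Rightarrow> bool" where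
  "elementary_on t E \<longleftrightarrow> (\<forall>(a, b, x, h)\<in>set E. 0 \<le> a \<and> a \<le> b \<and> b \<le> t)"

definition elementary_fun :: "'h::real_inner elementary \<Rightarrow> real \<Rightarrow> ('h \<Rightarrow>\<^sub>L 'h)" where
  "elementary_fun E r =
     (\<Sum>(a, b, x, h)\<leftarrow>E.
        indicat_real {a<..b} r *\<^sub>R (blinfun_scaleR_left h o\<^sub>L blinfun_inner_right x))"

definition elementary_integral ::
  "(real \<Rightarrow> 'h \<Rightarrow> 'w \<Rightarrow> real) \<Rightarrow> 'h::real_inner elementary \<Rightarrow> 'w \<Rightarrow> 'h" where
  "elementary_integral W E \<omega> = (\<Sum>(a, b, x, h)\<leftarrow>E. (W b x \<omega> - W a x \<omega>) *\<^sub>R h)"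

text \<open>
  \<open>I\<close> is (a version of) the stochastic integral of \<open>\<Phi>\<close> over \<open>[0, t]\<close> with respect to \<open>W\<close>, that
  is, the value at \<open>\<Phi>\<close> of the extension of \<^const>\<open>elementary_integral\<close> given by the Ito
  isometry \<open>E \<parallel>I\<parallel>\<^sup>2 = \<integral>\<^sub>0\<^sup>t \<parallel>\<Phi>(r) Q\<^sup>1\<^sup>/\<^sup>2\<parallel>\<^sup>2 dr\<close> (Hilbert--Schmidt norm on the right-hand side).
  Adapted random integrands are not needed, as the integrands of mild solutions are deterministic.
\<close>

definition stoch_integral ::
  "'w measure \<Rightarrow> ('h::{real_inner, banach, second_countable_topology} \<Rightarrow>\<^sub>L 'h) \<Rightarrow>
   (real \<Rightarrow> 'h \<Rightarrow> 'w \<Rightarrow> real) \<Rightarrow> real \<Rightarrow> (real \<Rightarrow> ('h \<Rightarrow>\<^sub>L 'h)) \<Rightarrow> ('w \<Rightarrow> 'h) \<Rightarrow> bool" where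
  "stoch_integral M Q W t \<Phi> I \<longleftrightarrow>
     (\<forall>x. set_borel_measurable lborel {0..t} (\<lambda>r. \<Phi> r x)) \<and>
     I \<in> borel_measurable M \<and>
     (\<exists>E :: nat \<Rightarrow> 'h elementary.
        (\<forall>n. elementary_on t (E n)) \<and>
        (\<lambda>n. \<integral>\<^sup>+ r\<in>{0..t}. hs_norm_sq ((\<Phi> r - elementary_fun (E n) r) o\<^sub>L sqrt_op Q) \<partial>lborel)
          \<longlonglongrightarrow> 0 \<and>
        (\<lambda>n. \<integral>\<^sup>+ \<omega>. ennreal ((norm (I \<omega> - elementary_integral W (E n) \<omega>))\<^sup>2) \<partial>M) \<longlonglongrightarrow> 0)"

section \<open>Mild solutions and covariance operators\<close>

definition predictable_sigma ::
  "'w measure \<Rightarrow> (real \<Rightarrow> 'w measure) \<Rightarrow> real \<Rightarrow> (real \<times> 'w) measure" where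
  "predictable_sigma M F T =
     sigma ({0..T} \<times> space M)
       ({{s<..t} \<times> A | s t A. 0 \<le> s \<and> s < t \<and> t \<le> T \<and> A \<in> sets (F s)} \<union>
        {{0} \<times> A | A. A \<in> sets (F 0)})"

definition mild_solution ::
  "'w measure \<Rightarrow> (real \<Rightarrow> 'w measure) \<Rightarrow>
   ('h::{real_inner, banach, second_countable_topology} \<Rightarrow>\<^sub>L 'h) \<Rightarrow>
   (real \<Rightarrow> 'h \<Rightarrow> 'w \<Rightarrow> real) \<Rightarrow> (real \<Rightarrow> ('h \<Rightarrow>\<^sub>L 'h)) \<Rightarrow> real \<Rightarrow> real \<Rightarrow> (real \<Rightarrow> 'w \<Rightarrow> 'h) \<Rightarrow> bool"
where
  "mild_solution M F Q W S \<gamma> T Z \<longleftrightarrow>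
     (\<lambda>(t, \<omega>). Z t \<omega>) \<in> borel_measurable (predictable_sigma M F T) \<and>
     (\<forall>t\<in>{0..T}. \<exists>I.
        stoch_integral M Q W t (\<lambda>r. (t - r) powr (\<gamma> - 1) *\<^sub>R S (t - r)) I \<and>
        (AE \<omega> in M. Z t \<omega> = (1 / Gamma \<gamma>) *\<^sub>R I \<omega>))"

text \<open>
  For square-integrable \<open>X\<close> and \<open>Y\<close> the operator below exists by the Riesz representation theorem;
  uniqueness is immediate.
\<close>

definition covariance_op ::
  "'w measure \<Rightarrow> ('w \<Rightarrow> 'h::{real_inner, banach, second_countable_topology}) \<Rightarrow> ('w \<Rightarrow> 'h) \<Rightarrow>
   ('h \<Rightarrow>\<^sub>L 'h)" where
  "covariance_op M X Y =
     (THE C :: 'h \<Rightarrow>\<^sub>L 'h. \<forall>x y. C x \<bullet> y =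
        (\<integral>\<omega>. ((X \<omega> - integral\<^sup>L M X) \<bullet> x) * ((Y \<omega> - integral\<^sup>L M Y) \<bullet> y) \<partial>M))"

end

theory Submission
  imports Defs
begin

text \<open>
  Pairing the stochastic integral with a vector \<open>x\<close> moves the integrand to its adjoint:
  \<open>(\<integral>\<Phi> dW) \<bullet> x\<close> is the real Wiener integral of \<open>r \<mapsto> \<Phi>(r)\<^sup>* x\<close>.  Since \<open>W\<close> has independent
  increments with covariance \<open>(t - s) Q\<close>, the polarised Ito isometry for two deterministic integrands reads
  \<open>E[((\<integral>\<Phi> dW) \<bullet> x) ((\<integral>\<Psi> dW) \<bullet> y)] = \<integral> Q \<Phi>(r)\<^sup>* x \<bullet> \<Psi>(r)\<^sup>* y dr = (\<integral> \<Psi>(r) Q \<Phi>(r)\<^sup>* x dr) \<bullet> y\<close>,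
  where both integrands are extended by zero, so that only \<open>[0, min s t]\<close> contributes.  With
  \<open>\<Phi>(r) = (s - r)\<^sup>\<gamma>\<^sup>-\<^sup>1 S(s - r)\<close>, \<open>\<Psi>(r) = (t - r)\<^sup>\<gamma>\<^sup>-\<^sup>1 S(t - r)\<close> and mean zero, this is the claim.

  The isometry is an identity of has-integral statements that is bilinear in the pair of
  integrands; for elementary ones it follows by adding up single intervals
  (\<open>elementary_isometry\<close>), where it is the covariance of two increments of \<open>W\<close>
  (\<open>W_increment_covariance\<close>).  Both of its sides are \<open>L\<^sup>2\<close> inner products, the right-hand one because
  \<open>Q = R R\<close> with \<open>R\<close> the self-adjoint square root.  Inner products are continuous along \<open>L\<^sup>2\<close> limits
  (\<open>L2_limit_inner\<close>), and the approximation that defines the stochastic integral is an \<open>L\<^sup>2\<close>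
  approximation of \<open>R \<Phi>(r)\<^sup>* x\<close>, since
  \<open>\<parallel>R K\<^sup>* x\<parallel> \<le> \<parallel>x\<parallel> \<parallel>K R\<parallel>\<close> and the operator norm is at most the Hilbert--Schmidt norm
  (\<open>norm_root_adjoint_le\<close>, \<open>norm_le_hs_norm_sq\<close>).  The same bound makes
  \<open>\<Psi>(r) Q \<Phi>(r)\<^sup>* x = (\<Psi>(r) R) (R \<Phi>(r)\<^sup>* x)\<close> Bochner integrable: it is a product of two
  square integrable factors.

  Besides the covariance operator, which the proof constructs, three objects in the statement are
  given by choice or description operators.  Each needs an existence theorem of Hilbert space theory
  before it can be used: the adjoint (Riesz representation), the orthonormal basis in the
  Hilbert--Schmidt norm (Zorn's lemma and orthogonal projection), and the square root of \<open>Q\<close>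
  (a contraction argument).
\<close>

section \<open>Projection, duality and orthonormal bases in Hilbert space\<close>

text \<open>
  Closed balls need not be compact here, so a minimising sequence replaces compactness: the
  parallelogram law forces it to be Cauchy, because midpoints stay in the subspace.
\<close>

lemma nearest_point_in_closed_subspace:
  fixes V :: "'h::{real_inner, banach} set"
  assumes V: "subspace V" "closed V"
  obtains p where "p \<in> V" "\<And>v. v \<in> V \<Longrightarrow> norm (x - p) \<le> norm (x - v)"
proof -
  have ne: "V \<noteq> {}"
    using subspace_0[OF V(1)] by auto
  define d where "d = infdist x V"
  have d0: "0 \<le> d"
    by (simp add: d_def infdist_nonneg)
  have low: "d \<le> norm (x - v)" if "v \<in> V" for v
    using infdist_le[OF that, of x] by (simp add: d_def dist_norm)
  have "\<exists>v\<in>V. norm (x - v) < d + 1 / Suc n" for n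
  proof (rule ccontr)
    assume "\<not> ?thesis"
    then have "d + 1 / Suc n \<le> infdist x V"
      unfolding infdist_notempty[OF ne] using ne
      by (intro cINF_greatest) (auto simp: dist_norm not_less)
    then show False
      by (simp add: d_def)
  qed
  then obtain p where p: "p n \<in> V" "norm (x - p n) < d + 1 / Suc n" for n
    by metis
  have lim: "(\<lambda>n. norm (x - p n)) \<longlonglongrightarrow> d"
  proof (rule tendsto_sandwich[where f = "\<lambda>_. d" and h = "\<lambda>n. d + 1 / Suc n"])
    show "(\<lambda>n. d + 1 / Suc n) \<longlonglongrightarrow> d"
      using tendsto_add[OF tendsto_const[of d] LIMSEQ_inverse_real_of_nat]
      by (simp add: inverse_eq_divide)
    show "\<forall>\<^sub>F n in sequentially. norm (x - p n) \<le> d + 1 / Suc n"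
      using p(2) by (simp add: less_imp_le)
  qed (use low p(1) in auto)
  (* the parallelogram law, applied to x - p m and x - p n *)
  have gap: "(norm (p m - p n))\<^sup>2 \<le> 2 * ((norm (x - p m))\<^sup>2 - d\<^sup>2) + 2 * ((norm (x - p n))\<^sup>2 - d\<^sup>2)" for m n
  proof -
    have "(1/2) *\<^sub>R (p m + p n) \<in> V"
      using p(1) V(1) by (intro subspace_scale subspace_add) auto
    from low[OF this] have "d\<^sup>2 \<le> (norm (x - (1/2) *\<^sub>R (p m + p n)))\<^sup>2"
      using d0 by (intro power_mono)
    moreover have "(norm (p m - p n))\<^sup>2 + 4 * (norm (x - (1/2) *\<^sub>R (p m + p n)))\<^sup>2
        = 2 * (norm (x - p m))\<^sup>2 + 2 * (norm (x - p n))\<^sup>2"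
      by (simp add: power2_norm_eq_inner inner_diff inner_add inner_commute field_simps)
    ultimately show ?thesis
      by simp
  qed
  have "Cauchy p"
  proof (rule CauchyI)
    fix e :: real
    assume e: "0 < e"
    have "(\<lambda>n. (norm (x - p n))\<^sup>2) \<longlonglongrightarrow> d\<^sup>2"
      by (intro tendsto_power lim)
    then have "\<forall>\<^sub>F n in sequentially. (norm (x - p n))\<^sup>2 < d\<^sup>2 + e\<^sup>2 / 4"
      using e by (intro order_tendstoD) auto
    then obtain N where N: "(norm (x - p n))\<^sup>2 < d\<^sup>2 + e\<^sup>2 / 4" if "N \<le> n" for n
      by (auto simp: eventually_sequentially)
    have "norm (p m - p n) < e" if "N \<le> m" "N \<le> n" for m n
    proof -
      have "(norm (p m - p n))\<^sup>2 < e\<^sup>2"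
        using gap[of m n] N[OF that(1)] N[OF that(2)] by argo
      then show ?thesis
        using e by (simp add: power2_less_imp_less)
    qed
    then show "\<exists>N. \<forall>m\<ge>N. \<forall>n\<ge>N. norm (p m - p n) < e"
      by blast
  qed
  then obtain q where q: "p \<longlonglongrightarrow> q"
    by (auto simp: Cauchy_convergent_iff convergent_def)
  show thesis
  proof (rule that)
    show "q \<in> V"
      using closed_sequentially[OF V(2) _ q] p(1) by auto
    have "(\<lambda>n. norm (x - p n)) \<longlonglongrightarrow> norm (x - q)"
      by (intro tendsto_intros q)
    then have "norm (x - q) = d"
      using lim LIMSEQ_unique by blast
    then show "norm (x - q) \<le> norm (x - v)" if "v \<in> V" for v
      using low[OF that] by simp
  qed
qed

text \<open>
  The difference between a point outside \<open>V\<close> and its nearest point in \<open>V\<close>: if it were not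
  orthogonal to some \<open>v\<close>, moving along \<open>v\<close> would give a nearer point.
\<close>

lemma closed_proper_subspace_has_normal:
  fixes V :: "'h::{real_inner, banach} set"
  assumes V: "subspace V" "closed V" and ne: "V \<noteq> UNIV"
  obtains w where "w \<noteq> 0" "\<And>v. v \<in> V \<Longrightarrow> w \<bullet> v = 0"
proof -
  obtain x where x: "x \<notin> V"
    using ne by auto
  obtain p where p: "p \<in> V" "\<And>v. v \<in> V \<Longrightarrow> norm (x - p) \<le> norm (x - v)"
    using nearest_point_in_closed_subspace[OF V] by blast
  define w where "w = x - p"
  have "w \<bullet> v = 0" if v: "v \<in> V" for v
  proof (cases "v = 0")
    case False
    define c where "c = (w \<bullet> v) / (v \<bullet> v)"
    have "p + c *\<^sub>R v \<in> V"
      using p(1) v V(1) by (intro subspace_add subspace_scale) auto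
    then have "norm w \<le> norm (w - c *\<^sub>R v)"
      using p(2) by (fastforce simp: w_def algebra_simps)
    then have "(norm w)\<^sup>2 \<le> (norm (w - c *\<^sub>R v))\<^sup>2"
      by (intro power_mono) auto
    also have "\<dots> = (norm w)\<^sup>2 - (w \<bullet> v)\<^sup>2 / (v \<bullet> v)"
      using False unfolding power2_norm_eq_inner
      by (simp add: inner_diff inner_commute c_def power2_eq_square)
    finally have "(w \<bullet> v)\<^sup>2 / (v \<bullet> v) \<le> 0"
      by simp
    moreover have "0 < v \<bullet> v"
      using False by simp
    ultimately show ?thesis
      by (simp add: divide_le_0_iff)
  qed simp
  moreover have "w \<noteq> 0"
    using x p(1) by (auto simp: w_def)
  ultimately show thesis
    using that by blast
qed

text \<open>
  A normal vector \<open>w\<close> of the kernel represents \<open>f\<close> up to scaling, as \<open>f x *\<^sub>R w - f w *\<^sub>R x\<close> lies in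
  the kernel.
\<close>

lemma Riesz_representation:
  fixes f :: "'h::{real_inner, banach} \<Rightarrow> real"
  assumes f: "bounded_linear f"
  obtains z where "\<And>x. f x = x \<bullet> z"
proof -
  interpret bounded_linear f by fact
  define V where "V = {x. f x = 0}"
  show thesis
  proof (cases "V = UNIV")
    case True
    then show thesis
      using that[of 0] by (auto simp: V_def)
  next
    case False
    have "subspace V"
      by (auto simp: V_def subspace_def add scaleR)
    moreover have "closed V"
      unfolding V_def by (intro closed_Collect_eq continuous_intros continuous_on f)
    ultimately obtain w where w: "w \<noteq> 0" "\<And>v. f v = 0 \<Longrightarrow> w \<bullet> v = 0"
      using closed_proper_subspace_has_normal[OF _ _ False] by (auto simp: V_def)
    show thesis
    proof (rule that)
      fix x
      have "f (f x *\<^sub>R w - f w *\<^sub>R x) = 0"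
        by (simp add: diff scaleR)
      from w(2)[OF this] show "f x = x \<bullet> ((f w / (w \<bullet> w)) *\<^sub>R w)"
        using w(1) by (simp add: inner_diff field_simps inner_commute)
    qed
  qed
qed

text \<open>
  The adjoint is a function chosen by its defining identity; Riesz representation is what makes
  the choice succeed beyond Euclidean spaces.
\<close>

lemma adjoint_works_Hilbert:
  fixes K :: "'h::{real_inner, banach} \<Rightarrow>\<^sub>L 'h"
  shows "x \<bullet> adjoint K y = K x \<bullet> y"
proof -
  have "\<exists>z. \<forall>x. K x \<bullet> y = x \<bullet> z" for y
    using Riesz_representation[of "\<lambda>x. K x \<bullet> y"]
    by (metis blinfun.bounded_linear_right bounded_linear_inner_left_comp)
  then obtain g where "\<And>x y. K x \<bullet> y = x \<bullet> g y"
    by metis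
  then show ?thesis
    using adjoint_unique[of K g] by simp
qed

lemma adjoint_eqI:
  fixes K :: "'h::{real_inner, banach} \<Rightarrow>\<^sub>L 'h"
  assumes "\<And>u. K u \<bullet> y = u \<bullet> v"
  shows "adjoint K y = v"
  using assms adjoint_works_Hilbert[of _ K y] by (metis vector_eq_ldot)

lemma adjoint_blinfun_simps:
  fixes K L :: "'h::{real_inner, banach} \<Rightarrow>\<^sub>L 'h"
  shows "adjoint (K + L) y = adjoint K y + adjoint L y"
    "adjoint (K - L) y = adjoint K y - adjoint L y"
    "adjoint (c *\<^sub>R K) y = c *\<^sub>R adjoint K y"
    "adjoint (blinfun_apply 0) y = (0::'h)"
    "adjoint K (y + z) = adjoint K y + adjoint K z"
    "adjoint K (c *\<^sub>R y) = c *\<^sub>R adjoint K y"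
  by (rule adjoint_eqI; simp add: blinfun.bilinear_simps inner_add inner_diff adjoint_works_Hilbert)+

text \<open>
  For self-adjoint \<open>R\<close> the operators \<open>R K\<^sup>*\<close> and \<open>K R\<close> are adjoint to each other, hence have the
  same norm.  This turns bounds on \<open>K R\<close>, which the isometry of the stochastic integral supplies,
  into bounds on the integrands of the weak pairings.
\<close>

lemma norm_root_adjoint_le:
  fixes K R :: "'h::{real_inner, banach} \<Rightarrow>\<^sub>L 'h"
  assumes "self_adjoint_op R"
  shows "norm (R (adjoint K y)) \<le> norm y * norm (K o\<^sub>L R)"
proof -
  define v where "v = R (adjoint K y)"
  have "norm v * norm v = adjoint K y \<bullet> R v"
    using assms by (simp add: v_def self_adjoint_op_def power2_norm_eq_inner[symmetric] power2_eq_square[symmetric])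
      (simp add: power2_norm_eq_inner)
  also have "\<dots> = (K o\<^sub>L R) v \<bullet> y"
    by (simp add: inner_commute[of _ "R v"] adjoint_works_Hilbert)
  also have "\<dots> \<le> norm (K o\<^sub>L R) * norm v * norm y"
    by (intro order_trans[OF norm_cauchy_schwarz] mult_right_mono norm_blinfun) auto
  finally have "norm v * norm v \<le> norm v * (norm y * norm (K o\<^sub>L R))"
    by (simp add: mult_ac)
  then show ?thesis
    by (cases "norm v = 0") (auto simp: v_def[symmetric])
qed

lemma subspace_closure:
  fixes V :: "'a::real_normed_vector set"
  assumes "subspace V"
  shows "subspace (closure V)"
proof (rule subspaceI)
  show "0 \<in> closure V"
    using subspace_0[OF assms] closure_subset by blast
next
  fix x y assume "x \<in> closure V" "y \<in> closure V"
  then obtain f g where "\<And>n. f n \<in> V" "f \<longlonglongrightarrow> x" "\<And>n. g n \<in> V" "g \<longlonglongrightarrow> y"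
    unfolding closure_sequential by blast
  then have "(\<forall>n. f n + g n \<in> V) \<and> (\<lambda>n. f n + g n) \<longlonglongrightarrow> x + y"
    by (auto intro: tendsto_add subspace_add[OF assms])
  then show "x + y \<in> closure V"
    unfolding closure_sequential by (intro exI[of _ "\<lambda>n. f n + g n"])
next
  fix c x assume "x \<in> closure V"
  then obtain f where "\<And>n. f n \<in> V" "f \<longlonglongrightarrow> x"
    unfolding closure_sequential by blast
  then have "(\<forall>n. c *\<^sub>R f n \<in> V) \<and> (\<lambda>n. c *\<^sub>R f n) \<longlonglongrightarrow> c *\<^sub>R x"
    by (auto intro: tendsto_scaleR subspace_scale[OF assms])
  then show "c *\<^sub>R x \<in> closure V"
    unfolding closure_sequential by (intro exI[of _ "\<lambda>n. c *\<^sub>R f n"])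
qed

text \<open>
  A maximal orthonormal set spans a dense subspace, since a normal vector of the closed span
  could otherwise be normalised and added.
\<close>

lemma orthonormal_basis_exists:
  "\<exists>B :: 'h::{real_inner, banach} set. orthonormal_basis B"
proof -
  define \<A> where "\<A> = {B :: 'h set. pairwise orthogonal B \<and> (\<forall>e\<in>B. norm e = 1)}"
  have "\<exists>B\<in>\<A>. \<forall>X\<in>\<A>. B \<subseteq> X \<longrightarrow> X = B"
  proof (rule subset_Zorn')
    fix \<C>
    assume C: "subset.chain \<A> \<C>"
    then have sub: "\<C> \<subseteq> \<A>" and chain: "\<And>X Y. X \<in> \<C> \<Longrightarrow> Y \<in> \<C> \<Longrightarrow> X \<subseteq> Y \<or> Y \<subseteq> X"
      by (auto simp: subset_chain_def)
    have "orthogonal a b" if XY: "X \<in> \<C>" "Y \<in> \<C>" and ab: "a \<in> X" "b \<in> Y" "a \<noteq> b" for a b X Y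
    proof -
      obtain U where "U \<in> \<C>" "a \<in> U" "b \<in> U"
        using chain[OF XY] XY ab by blast
      then show ?thesis
        using sub ab(3) by (auto simp: \<A>_def pairwise_def)
    qed
    then show "\<Union>\<C> \<in> \<A>"
      using sub by (auto simp: \<A>_def pairwise_def)
  qed
  then obtain B where B: "B \<in> \<A>" and max: "\<And>X. X \<in> \<A> \<Longrightarrow> B \<subseteq> X \<Longrightarrow> X = B"
    by metis
  have "closure (span B) = UNIV"
  proof (rule ccontr)
    assume ne: "closure (span B) \<noteq> UNIV"
    obtain w where w: "w \<noteq> 0" "\<And>v. v \<in> closure (span B) \<Longrightarrow> w \<bullet> v = 0"
      using closed_proper_subspace_has_normal[OF subspace_closure[OF subspace_span] closed_closure ne] by blast
    define e where "e = (1 / norm w) *\<^sub>R w"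
    have perp: "orthogonal e v \<and> orthogonal v e" if "v \<in> B" for v
      using w(2)[of v] that closure_subset[of "span B"] span_base[OF that]
      by (auto simp: e_def orthogonal_def inner_commute)
    have "norm e = 1"
      using w(1) by (simp add: e_def)
    then have "insert e B \<in> \<A>"
      using B perp by (auto simp: \<A>_def pairwise_insert)
    from max[OF this] have "e \<in> B"
      by auto
    from perp[OF this] \<open>norm e = 1\<close> show False
      by (auto simp: orthogonal_def)
  qed
  then show ?thesis
    using B unfolding \<A>_def orthonormal_basis_def by blast
qed

text \<open>
  On finite combinations of basis vectors the bound is the Cauchy--Schwarz inequality for the
  coefficients; density of the span carries it over to all vectors.
\<close>

lemma norm_le_hs_norm_sq:
  fixes K :: "'h::{real_inner, banach} \<Rightarrow>\<^sub>L 'h"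
  shows "ennreal ((norm K)\<^sup>2) \<le> hs_norm_sq K"
proof (cases "hs_norm_sq K")
  case (real c)
  define B :: "'h set" where "B = (SOME B. orthonormal_basis B)"
  have "orthonormal_basis B"
    unfolding B_def by (rule someI_ex) (rule orthonormal_basis_exists)
  then have B: "pairwise orthogonal B" "\<And>e. e \<in> B \<Longrightarrow> norm e = 1" "closure (span B) = UNIV"
    by (auto simp: orthonormal_basis_def)
  have part: "(\<Sum>e\<in>F. (norm (K e))\<^sup>2) \<le> c" if "finite F" "F \<subseteq> B" for F
  proof -
    have "ennreal (\<Sum>e\<in>F. (norm (K e))\<^sup>2) = (\<integral>\<^sup>+ e. ennreal ((norm (K e))\<^sup>2) \<partial>count_space F)"
      using that by (simp add: nn_integral_count_space_finite sum_ennreal)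
    also have "\<dots> = (\<integral>\<^sup>+ e. ennreal ((norm (K e))\<^sup>2) * indicator F e \<partial>count_space B)"
      using that(2)
      by (auto simp: nn_integral_count_space_indicator indicator_def intro!: nn_integral_cong)
    also have "\<dots> \<le> hs_norm_sq K"
      unfolding hs_norm_sq_def B_def[symmetric]
      by (intro nn_integral_mono) (auto simp: indicator_def)
    finally show ?thesis
      using real by (simp add: ennreal_le_iff)
  qed
  have on_span: "norm (K z) \<le> sqrt c * norm z" if "z \<in> span B" for z
  proof -
    obtain F r where F: "finite F" "F \<subseteq> B" and z: "z = (\<Sum>e\<in>F. r e *\<^sub>R e)"
      using \<open>z \<in> span B\<close> unfolding span_explicit by blast
    have nz: "(norm z)\<^sup>2 = (\<Sum>e\<in>F. (r e)\<^sup>2)"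
    proof -
      have "(norm z)\<^sup>2 = (\<Sum>e\<in>F. (norm (r e *\<^sub>R e))\<^sup>2)"
        unfolding z using B(1) F
        by (intro norm_sum_Pythagorean) (auto simp: pairwise_def orthogonal_def subset_iff)
      also have "\<dots> = (\<Sum>e\<in>F. (r e)\<^sup>2)"
        using B(2) F by (intro sum.cong) auto
      finally show ?thesis .
    qed
    have "norm (K z) \<le> (\<Sum>e\<in>F. \<bar>r e\<bar> * norm (K e))"
      unfolding z by (simp add: blinfun.sum_right blinfun.scaleR_right order_trans[OF norm_sum])
    also have "\<dots> \<le> L2_set r F * L2_set (\<lambda>e. norm (K e)) F"
      using L2_set_mult_ineq[of r "\<lambda>e. norm (K e)" F] by simp
    also have "\<dots> = norm z * sqrt (\<Sum>e\<in>F. (norm (K e))\<^sup>2)"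
      by (simp add: L2_set_def nz[symmetric])
    also have "\<dots> \<le> norm z * sqrt c"
      using part[OF F] by (intro mult_left_mono) auto
    finally show ?thesis
      by (simp add: mult.commute)
  qed
  have "closed {z. norm (K z) \<le> sqrt c * norm z}"
    by (intro closed_Collect_le continuous_intros)
  then have "closure (span B) \<subseteq> {z. norm (K z) \<le> sqrt c * norm z}"
    using on_span by (intro closure_minimal) auto
  then have "norm K \<le> sqrt c"
    using B(3) real by (intro norm_blinfun_bound) auto
  then have "(norm K)\<^sup>2 \<le> c"
    using real by (metis norm_ge_zero power_mono real_sqrt_pow2)
  then show ?thesis
    using real by (simp add: ennreal_leI)
qed simp

section \<open>The square root of a coercive self-adjoint operator\<close>

text \<open>
  The operator \<open>id - Y\<close> is a square root of \<open>id - B\<close> exactly if \<open>2 Y = B + Y\<^sup>2\<close>.  This is a fixed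
  point equation for \<open>Y \<mapsto> (B + Y\<^sup>2) / 2\<close>, which is a contraction on a ball of radius less than 1.
  Restricting it to the self-adjoint operators that commute with everything that \<open>B\<close> commutes with
  keeps the domain complete and delivers these properties of \<open>Y\<close>; commutation is needed for the
  uniqueness of the root.
\<close>

lemma id_minus_contraction_has_square_root:
  fixes B :: "'h::{real_inner, banach} \<Rightarrow>\<^sub>L 'h"
  assumes sa: "self_adjoint_op B" and B: "norm B < 1"
  obtains Y where "self_adjoint_op Y" "norm Y < 1" "2 *\<^sub>R Y = B + (Y o\<^sub>L Y)"
    "\<And>C. C o\<^sub>L B = B o\<^sub>L C \<Longrightarrow> C o\<^sub>L Y = Y o\<^sub>L C"
proof -
  define b where "b = norm B"
  (* the fixed point of the scalar majorant y = (b + y^2) / 2 *)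
  define y where "y = 1 - sqrt (1 - b)"
  have b: "0 \<le> b" "b < 1"
    using B by (auto simp: b_def)
  have y: "0 \<le> y" "y < 1" and y_fix: "b + y * y = 2 * y"
    using b by (auto simp: y_def algebra_simps)
  define \<Y> where "\<Y> = {Y :: 'h \<Rightarrow>\<^sub>L 'h. norm Y \<le> y \<and> self_adjoint_op Y \<and>
     (\<forall>C. C o\<^sub>L B = B o\<^sub>L C \<longrightarrow> C o\<^sub>L Y = Y o\<^sub>L C)}"
  define G where "G Y = (1/2) *\<^sub>R (B + (Y o\<^sub>L Y))" for Y
  have "\<exists>!Y\<in>\<Y>. G Y = Y"
  proof (rule Banach_fix)
    have "\<Y> = cball 0 y \<inter> (\<Inter>u. \<Inter>v. {Y :: 'h \<Rightarrow>\<^sub>L 'h. Y u \<bullet> v = u \<bullet> Y v}) \<inter>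
       (\<Inter>C\<in>{C. C o\<^sub>L B = B o\<^sub>L C}. {Y. C o\<^sub>L Y = Y o\<^sub>L C})"
      by (auto simp: \<Y>_def self_adjoint_op_def)
    moreover have "closed \<dots>"
      by (intro closed_Int closed_INT ballI closed_cball closed_Collect_eq continuous_intros
          linear_continuous_on bounded_linear_intros
          bounded_bilinear.bounded_linear_left[OF bounded_bilinear_blinfun_compose]
          bounded_bilinear.bounded_linear_right[OF bounded_bilinear_blinfun_compose])
    ultimately show "Topological_Spaces.complete \<Y>"
      by (simp add: complete_eq_closed)
    have "0 \<in> \<Y>"
      using y by (auto simp: \<Y>_def self_adjoint_op_def)
    then show "\<Y> \<noteq> {}"
      by auto
    show "G ` \<Y> \<subseteq> \<Y>"
    proof safe
      fix Y assume "Y \<in> \<Y>"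
      then have Y: "norm Y \<le> y" "self_adjoint_op Y"
        "\<And>C. C o\<^sub>L B = B o\<^sub>L C \<Longrightarrow> C o\<^sub>L Y = Y o\<^sub>L C"
        by (auto simp: \<Y>_def)
      have "norm (G Y) \<le> (1/2) * (norm B + norm Y * norm Y)"
        unfolding G_def norm_scaleR
        by (intro mult_mono order_trans[OF norm_triangle_ineq] add_mono norm_blinfun_compose) auto
      also have "\<dots> \<le> (1/2) * (b + y * y)"
        using Y(1) y by (intro mult_left_mono add_mono mult_mono) (auto simp: b_def)
      also have "\<dots> = y"
        using y_fix by simp
      finally have "norm (G Y) \<le> y" .
      moreover have "self_adjoint_op (G Y)"
        using sa Y(2)
        by (simp add: self_adjoint_op_def G_def blinfun.bilinear_simps inner_add)
      moreover have "C o\<^sub>L G Y = G Y o\<^sub>L C" if C: "C o\<^sub>L B = B o\<^sub>L C" for C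
      proof -
        have "C (B x) = B (C x)" "C (Y x) = Y (C x)" for x
          using C Y(3)[OF C] by (metis blinfun_apply_blinfun_compose)+
        then show ?thesis
          by (auto simp: G_def blinfun.bilinear_simps intro!: blinfun_eqI)
      qed
      ultimately show "G Y \<in> \<Y>"
        by (simp add: \<Y>_def)
    qed
    show "dist (G X) (G Y) \<le> y * dist X Y" if XY: "X \<in> \<Y>" "Y \<in> \<Y>" for X Y
    proof -
      have "G X - G Y = (1/2) *\<^sub>R ((X o\<^sub>L (X - Y)) + ((X - Y) o\<^sub>L Y))"
        by (auto simp: G_def blinfun.bilinear_simps scaleR_diff_right[symmetric] intro!: blinfun_eqI)
      then have "dist (G X) (G Y) \<le> (1/2) * (norm X * norm (X - Y) + norm (X - Y) * norm Y)"
        by (simp add: dist_norm del: scaleR_half_double)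
          (intro order_trans[OF norm_triangle_ineq] add_mono norm_blinfun_compose)
      also have "\<dots> \<le> (1/2) * (y * norm (X - Y) + norm (X - Y) * y)"
        using XY by (intro mult_left_mono add_mono mult_mono) (auto simp: \<Y>_def y)
      finally show ?thesis
        by (simp add: dist_norm)
    qed
  qed (use y in auto)
  then obtain Y where Y: "Y \<in> \<Y>" "G Y = Y"
    by blast
  show thesis
  proof (rule that)
    have "2 *\<^sub>R Y = 2 *\<^sub>R G Y"
      using Y(2) by simp
    then show "2 *\<^sub>R Y = B + (Y o\<^sub>L Y)"
      by (simp add: G_def)
  qed (use Y y in \<open>auto simp: \<Y>_def\<close>)
qed

text \<open>
  Rescaling makes a coercive operator a perturbation of the identity:
  \<open>\<parallel>x - c Q x\<parallel>\<^sup>2 \<le> (1 - 2 c \<theta> + c\<^sup>2 \<parallel>Q\<parallel>\<^sup>2) \<parallel>x\<parallel>\<^sup>2\<close>, and the right-hand factor is below 1 for small \<open>c\<close>.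
\<close>

lemma norm_id_minus_coercive_less_1:
  fixes Q :: "'h::{real_inner, banach} \<Rightarrow>\<^sub>L 'h"
  assumes "strictly_positive_op Q"
  obtains c where "0 < c" "norm (id_blinfun - c *\<^sub>R Q) < 1"
proof -
  obtain \<theta>0 where \<theta>0: "0 < \<theta>0" "\<And>x. Q x \<bullet> x \<ge> \<theta>0 * (norm x)\<^sup>2"
    using assms by (auto simp: strictly_positive_op_def)
  \<comment> \<open>normalised bounds \<open>\<theta> \<le> 1 \<le> m\<close>, which give \<open>\<theta> / m \<le> 1\<close>\<close>
  define m where "m = norm Q + 1"
  define \<theta> where "\<theta> = min \<theta>0 1"
  have m: "0 < m" "norm Q \<le> m" "1 \<le> m" and \<theta>: "0 < \<theta>" "\<theta> \<le> 1"
    using \<theta>0 by (auto simp: m_def \<theta>_def add_nonneg_pos)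
  have coer: "Q x \<bullet> x \<ge> \<theta> * (norm x)\<^sup>2" for x
    using \<theta>0(2)[of x] by (rule order_trans[rotated]) (auto simp: \<theta>_def intro!: mult_right_mono)
  define c where "c = \<theta> / m\<^sup>2"
  have c: "0 < c"
    using m \<theta> by (simp add: c_def)
  \<comment> \<open>the choice of \<open>c\<close> minimises \<open>1 - 2 c \<theta> + c\<^sup>2 m\<^sup>2\<close>, and \<open>q\<close> is the minimum\<close>
  define q where "q = 1 - \<theta>\<^sup>2 / m\<^sup>2"
  have "\<theta>\<^sup>2 \<le> 1" "1 \<le> m\<^sup>2"
    using m \<theta> by (auto simp: power_le_one)
  then have q: "0 \<le> q" "q < 1"
    using m \<theta> by (auto simp: q_def field_simps)
  have "norm (id_blinfun - c *\<^sub>R Q) \<le> sqrt q"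
  proof (rule norm_blinfun_bound)
    fix x
    have "(norm ((id_blinfun - c *\<^sub>R Q) x))\<^sup>2 = (norm x)\<^sup>2 - 2 * c * (Q x \<bullet> x) + c\<^sup>2 * (norm (Q x))\<^sup>2"
      unfolding power2_norm_eq_inner
      by (simp add: blinfun.bilinear_simps inner_diff inner_commute power2_eq_square algebra_simps)
    also have "\<dots> \<le> (norm x)\<^sup>2 - 2 * c * (\<theta> * (norm x)\<^sup>2) + c\<^sup>2 * (m * norm x)\<^sup>2"
    proof -
      have "norm (Q x) \<le> m * norm x"
        using norm_blinfun[of Q x] m(2) by (meson mult_right_mono norm_ge_zero order_trans)
      then have "c\<^sup>2 * (norm (Q x))\<^sup>2 \<le> c\<^sup>2 * (m * norm x)\<^sup>2"
        by (intro mult_left_mono power_mono) auto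
      moreover have "2 * c * (\<theta> * (norm x)\<^sup>2) \<le> 2 * c * (Q x \<bullet> x)"
        using coer c by (intro mult_left_mono) auto
      ultimately show ?thesis
        by linarith
    qed
    also have "\<dots> = q * (norm x)\<^sup>2"
      using m(1) by (simp add: q_def c_def field_simps power2_eq_square)
    finally have "sqrt ((norm ((id_blinfun - c *\<^sub>R Q) x))\<^sup>2) \<le> sqrt (q * (norm x)\<^sup>2)"
      by (rule real_sqrt_le_mono)
    then show "norm ((id_blinfun - c *\<^sub>R Q) x) \<le> sqrt q * norm x"
      by (simp add: real_sqrt_mult)
  qed (use q in auto)
  also have "\<dots> < 1"
    using q by simp
  finally show thesis
    using c that by blast
qed

text \<open>
  Existence comes from the fixed point \<open>Y\<close> with \<open>id - Y\<close> coercive.  For uniqueness, another root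
  \<open>R'\<close> commutes with \<open>Q\<close>, hence with \<open>Y\<close> and \<open>R\<close>, so \<open>(R + R') (R' - R) = R' R' - R R = 0\<close>; as
  \<open>R\<close> is positive definite and \<open>R'\<close> is positive, \<open>R + R'\<close> is injective.
\<close>

lemma sqrt_op_of_coercive:
  fixes Q :: "'h::{real_inner, banach} \<Rightarrow>\<^sub>L 'h"
  assumes sa: "self_adjoint_op Q" and pos: "strictly_positive_op Q"
  shows "self_adjoint_op (sqrt_op Q)" "sqrt_op Q o\<^sub>L sqrt_op Q = Q"
proof -
  define is_root where
    "is_root R \<longleftrightarrow> self_adjoint_op R \<and> (\<forall>x. R x \<bullet> x \<ge> 0) \<and> R o\<^sub>L R = Q" for R
  obtain c where c: "0 < c" "norm (id_blinfun - c *\<^sub>R Q) < 1"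
    using norm_id_minus_coercive_less_1[OF pos] by blast
  define B where "B = id_blinfun - c *\<^sub>R Q"
  have "self_adjoint_op B"
    using sa by (simp add: B_def self_adjoint_op_def blinfun.bilinear_simps inner_diff)
  then obtain Y where Y: "self_adjoint_op Y" "norm Y < 1" "2 *\<^sub>R Y = B + (Y o\<^sub>L Y)"
    and comm: "\<And>C. C o\<^sub>L B = B o\<^sub>L C \<Longrightarrow> C o\<^sub>L Y = Y o\<^sub>L C"
    using id_minus_contraction_has_square_root c(2) unfolding B_def by blast
  have Yx: "Y (Y x) = 2 *\<^sub>R Y x - x + c *\<^sub>R Q x" for x
    using arg_cong[OF Y(3), of "\<lambda>K. K x"] by (simp add: B_def blinfun.bilinear_simps algebra_simps)
  define R where "R = (1 / sqrt c) *\<^sub>R (id_blinfun - Y)"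
  have root: "R o\<^sub>L R = Q"
  proof (rule blinfun_eqI)
    fix x
    have "(R o\<^sub>L R) x = (1 / c) *\<^sub>R (x - 2 *\<^sub>R Y x + Y (Y x))"
      using c(1) by (simp add: R_def blinfun.bilinear_simps algebra_simps scaleR_2)
    also have "\<dots> = Q x"
      using c(1) by (simp add: Yx)
    finally show "(R o\<^sub>L R) x = Q x" .
  qed
  have R_pos: "0 < R x \<bullet> x" if "x \<noteq> 0" for x
  proof -
    have "Y x \<bullet> x \<le> norm (Y x) * norm x"
      by (rule norm_cauchy_schwarz)
    also have "\<dots> \<le> norm Y * norm x * norm x"
      by (intro mult_right_mono norm_blinfun) auto
    also have "\<dots> < 1 * (norm x * norm x)"
      unfolding mult.assoc using Y(2) that by (intro mult_strict_right_mono) auto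
    finally have "Y x \<bullet> x < x \<bullet> x"
      by (simp add: power2_norm_eq_inner[symmetric] power2_eq_square)
    then show ?thesis
      using c(1) by (simp add: R_def blinfun.bilinear_simps inner_diff)
  qed
  have R: "is_root R"
    unfolding is_root_def
  proof (intro conjI allI root)
    show "self_adjoint_op R"
      using Y(1) by (simp add: R_def self_adjoint_op_def blinfun.bilinear_simps inner_diff)
    show "0 \<le> R x \<bullet> x" for x
      using R_pos[of x] by (cases "x = 0") auto
  qed
  have unique: "R' = R" if "is_root R'" for R'
  proof (rule blinfun_eqI)
    fix x
    have R': "R' o\<^sub>L R' = Q" "\<And>x. R' x \<bullet> x \<ge> 0"
      using that by (auto simp: is_root_def)
    have "R' o\<^sub>L Q = Q o\<^sub>L R'"
      unfolding R'(1)[symmetric] by (auto intro: blinfun_eqI)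
    then have "R' (Q u) = Q (R' u)" for u
      by (metis blinfun_apply_blinfun_compose)
    then have "R' o\<^sub>L B = B o\<^sub>L R'"
      by (auto simp: B_def blinfun.bilinear_simps intro!: blinfun_eqI)
    from comm[OF this] have "R' (Y u) = Y (R' u)" for u
      by (metis blinfun_apply_blinfun_compose)
    then have RR': "R' (R u) = R (R' u)" for u
      by (simp add: R_def blinfun.bilinear_simps)
    have sq: "R' (R' u) = R (R u)" for u
      using R'(1) root by (metis blinfun_apply_blinfun_compose)
    define y where "y = R' x - R x"
    have "R y + R' y = 0"
      by (simp add: y_def blinfun.bilinear_simps RR' sq)
    then have "R y \<bullet> y + R' y \<bullet> y = 0"
      by (metis inner_add_left inner_zero_left)
    then have "y = 0"
      using R_pos[of y] R'(2)[of y] by (cases "y = 0") auto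
    then show "R' x = R x"
      by (simp add: y_def)
  qed
  have "sqrt_op Q = R"
    unfolding sqrt_op_def is_root_def[symmetric] using R unique by (rule the_equality)
  then show "self_adjoint_op (sqrt_op Q)" "sqrt_op Q o\<^sub>L sqrt_op Q = Q"
    using R by (auto simp: is_root_def)
qed

section \<open>Square integrable functions and their limits\<close>

definition square_integrable :: "'a measure \<Rightarrow> ('a \<Rightarrow> 'b::{real_inner, second_countable_topology}) \<Rightarrow> bool" where
  "square_integrable N f \<longleftrightarrow> f \<in> borel_measurable N \<and> integrable N (\<lambda>x. (norm (f x))\<^sup>2)"

text \<open>
  The distance is a nonnegative integral rather than a Bochner integral, because this is
  the form in which approximations of the stochastic integral are given; it makes square
  integrability of the limit a consequence.
\<close>

definition L2_limit ::
  "'a measure \<Rightarrow> (nat \<Rightarrow> 'a \<Rightarrow> 'b::{real_inner, second_countable_topology}) \<Rightarrow> ('a \<Rightarrow> 'b) \<Rightarrow> bool" where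
  "L2_limit N fn f \<longleftrightarrow> (\<forall>n. square_integrable N (fn n)) \<and> f \<in> borel_measurable N \<and>
     (\<lambda>n. \<integral>\<^sup>+ x. ennreal ((norm (f x - fn n x))\<^sup>2) \<partial>N) \<longlonglongrightarrow> 0"

lemma square_integrable_measurable: "square_integrable N f \<Longrightarrow> f \<in> borel_measurable N"
  by (simp add: square_integrable_def)

lemma square_integrable_add:
  assumes f: "square_integrable N f" and g: "square_integrable N g"
  shows "square_integrable N (\<lambda>x. f x + g x)"
proof -
  have [measurable]: "f \<in> borel_measurable N" "g \<in> borel_measurable N"
    using f g by (auto simp: square_integrable_def)
  have "integrable N (\<lambda>x. (norm (f x + g x))\<^sup>2)"
  proof (rule Bochner_Integration.integrable_bound)
    show "integrable N (\<lambda>x. 2 * (norm (f x))\<^sup>2 + 2 * (norm (g x))\<^sup>2)"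
      using f g by (auto simp: square_integrable_def)
    have "(norm (f x + g x))\<^sup>2 \<le> 2 * (norm (f x))\<^sup>2 + 2 * (norm (g x))\<^sup>2" for x
      using zero_le_power2[of "norm (f x - g x)"]
      unfolding power2_norm_eq_inner by (simp add: inner_diff inner_add inner_commute)
    then show "AE x in N. norm ((norm (f x + g x))\<^sup>2) \<le> norm (2 * (norm (f x))\<^sup>2 + 2 * (norm (g x))\<^sup>2)"
      by auto
  qed simp
  then show ?thesis
    by (simp add: square_integrable_def)
qed

lemma square_integrable_scaleR:
  "square_integrable N f \<Longrightarrow> square_integrable N (\<lambda>x. c *\<^sub>R f x)"
  by (auto simp: square_integrable_def power_mult_distrib)

lemma square_integrable_diff:
  "square_integrable N f \<Longrightarrow> square_integrable N g \<Longrightarrow> square_integrable N (\<lambda>x. f x - g x)"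
  using square_integrable_add[of N f "\<lambda>x. (-1) *\<^sub>R g x"] square_integrable_scaleR[of N g "-1"] by simp

lemma square_integrable_bound:
  assumes "square_integrable N g" and [measurable]: "f \<in> borel_measurable N"
    and "\<And>x. norm (f x) \<le> norm (g x)"
  shows "square_integrable N f"
  unfolding square_integrable_def
proof
  show "integrable N (\<lambda>x. (norm (f x))\<^sup>2)"
    by (rule Bochner_Integration.integrable_bound[of _ "\<lambda>x. (norm (g x))\<^sup>2"])
      (use assms in \<open>auto simp: square_integrable_def power_mono\<close>)
qed fact

lemma square_integrable_inner:
  assumes f: "square_integrable N f" and g: "square_integrable N g"
  shows "integrable N (\<lambda>x. f x \<bullet> g x)"
proof (rule Bochner_Integration.integrable_bound)
  show "integrable N (\<lambda>x. ((norm (f x))\<^sup>2 + (norm (g x))\<^sup>2) / 2)"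
    using f g by (auto simp: square_integrable_def)
  show "(\<lambda>x. f x \<bullet> g x) \<in> borel_measurable N"
    using f g by (auto simp: square_integrable_def)
  have "\<bar>f x \<bullet> g x\<bar> \<le> ((norm (f x))\<^sup>2 + (norm (g x))\<^sup>2) / 2" for x
    using Cauchy_Schwarz_ineq2[of "f x" "g x"] sum_squares_bound[of "norm (f x)" "norm (g x)"]
    by (simp add: field_simps)
  then show "AE x in N. norm (f x \<bullet> g x) \<le> norm (((norm (f x))\<^sup>2 + (norm (g x))\<^sup>2) / 2)"
    by auto
qed

text \<open>
  The quadratic \<open>t \<mapsto> \<integral> \<parallel>f - t g\<parallel>\<^sup>2\<close> is nonnegative; evaluate it at its minimum.
\<close>

lemma L2_Cauchy_Schwarz:
  assumes f: "square_integrable N f" and g: "square_integrable N g"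
  shows "\<bar>\<integral>x. f x \<bullet> g x \<partial>N\<bar> \<le> sqrt (\<integral>x. (norm (f x))\<^sup>2 \<partial>N) * sqrt (\<integral>x. (norm (g x))\<^sup>2 \<partial>N)"
proof -
  define a b c where "a = (\<integral>x. (norm (f x))\<^sup>2 \<partial>N)" and "b = (\<integral>x. (norm (g x))\<^sup>2 \<partial>N)"
    and "c = (\<integral>x. f x \<bullet> g x \<partial>N)"
  have int: "integrable N (\<lambda>x. (norm (f x))\<^sup>2)" "integrable N (\<lambda>x. (norm (g x))\<^sup>2)"
    "integrable N (\<lambda>x. f x \<bullet> g x)"
    using f g square_integrable_inner[OF f g] by (auto simp: square_integrable_def)
  have nonneg: "0 \<le> a" "0 \<le> b"
    by (auto simp: a_def b_def)
  have quad: "0 \<le> a - 2 * t * c + t\<^sup>2 * b" for t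
  proof -
    have "0 \<le> (\<integral>x. (norm (f x - t *\<^sub>R g x))\<^sup>2 \<partial>N)"
      by simp
    also have "\<dots> = (\<integral>x. (norm (f x))\<^sup>2 - 2 * t * (f x \<bullet> g x) + t\<^sup>2 * (norm (g x))\<^sup>2 \<partial>N)"
      unfolding power2_norm_eq_inner
      by (intro Bochner_Integration.integral_cong)
        (simp_all add: inner_diff inner_commute algebra_simps power2_eq_square)
    also have "\<dots> = a - 2 * t * c + t\<^sup>2 * b"
      using int by (simp add: a_def b_def c_def)
    finally show ?thesis .
  qed
  have "c\<^sup>2 \<le> a * b"
  proof (cases "b = 0")
    case True
    have "c = 0"
      using quad[of "(a + 1) / (2 * c)"] True by (cases "c = 0") auto
    then show ?thesis
      using True by simp
  next
    case False
    then have "0 < b"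
      using nonneg by simp
    then show ?thesis
      using quad[of "c / b"] by (simp add: field_simps power2_eq_square)
  qed
  then have "sqrt (c\<^sup>2) \<le> sqrt (a * b)"
    by (rule real_sqrt_le_mono)
  then show ?thesis
    by (simp add: real_sqrt_mult a_def b_def c_def)
qed

lemma L2_limitI:
  assumes sq: "\<And>n. square_integrable N (fn n)" and f: "f \<in> borel_measurable N"
    and g [measurable]: "\<And>n. g n \<in> borel_measurable N"
    and bound: "\<And>n x. norm (f x - fn n x) \<le> C * g n x"
    and lim: "(\<lambda>n. \<integral>\<^sup>+ x. ennreal ((g n x)\<^sup>2) \<partial>N) \<longlonglongrightarrow> 0"
  shows "L2_limit N fn f"
  unfolding L2_limit_def
proof (intro conjI allI sq f)
  have le: "(\<integral>\<^sup>+ x. ennreal ((norm (f x - fn n x))\<^sup>2) \<partial>N) \<le> ennreal (C\<^sup>2) * (\<integral>\<^sup>+ x. ennreal ((g n x)\<^sup>2) \<partial>N)" for n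
  proof -
    have "(\<integral>\<^sup>+ x. ennreal ((norm (f x - fn n x))\<^sup>2) \<partial>N) \<le> (\<integral>\<^sup>+ x. ennreal (C\<^sup>2) * ennreal ((g n x)\<^sup>2) \<partial>N)"
    proof (intro nn_integral_mono)
      fix x
      have "(norm (f x - fn n x))\<^sup>2 \<le> (C * g n x)\<^sup>2"
        by (intro power_mono bound) auto
      then show "ennreal ((norm (f x - fn n x))\<^sup>2) \<le> ennreal (C\<^sup>2) * ennreal ((g n x)\<^sup>2)"
        by (simp add: ennreal_mult[symmetric] power_mult_distrib ennreal_leI)
    qed
    also have "\<dots> = ennreal (C\<^sup>2) * (\<integral>\<^sup>+ x. ennreal ((g n x)\<^sup>2) \<partial>N)"
      by (rule nn_integral_cmult) measurable
    finally show ?thesis .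
  qed
  have "(\<lambda>n. ennreal (C\<^sup>2) * (\<integral>\<^sup>+ x. ennreal ((g n x)\<^sup>2) \<partial>N)) \<longlonglongrightarrow> ennreal (C\<^sup>2) * 0"
    by (intro ennreal_tendsto_cmult lim) simp
  then have lim0: "(\<lambda>n. ennreal (C\<^sup>2) * (\<integral>\<^sup>+ x. ennreal ((g n x)\<^sup>2) \<partial>N)) \<longlonglongrightarrow> 0"
    by simp
  show "(\<lambda>n. \<integral>\<^sup>+ x. ennreal ((norm (f x - fn n x))\<^sup>2) \<partial>N) \<longlonglongrightarrow> 0"
    by (rule tendsto_sandwich[OF _ _ tendsto_const lim0]) (auto intro: always_eventually le)
qed

lemma L2_limit_square_integrable:
  assumes "L2_limit N fn f"
  shows "square_integrable N f"
proof -
  have fn: "\<And>n. square_integrable N (fn n)" and [measurable]: "f \<in> borel_measurable N"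
    and lim: "(\<lambda>n. \<integral>\<^sup>+ x. ennreal ((norm (f x - fn n x))\<^sup>2) \<partial>N) \<longlonglongrightarrow> 0"
    using assms by (auto simp: L2_limit_def)
  have [measurable]: "fn n \<in> borel_measurable N" for n
    using fn square_integrable_measurable by blast
  from lim have "\<forall>\<^sub>F n in sequentially. (\<integral>\<^sup>+ x. ennreal ((norm (f x - fn n x))\<^sup>2) \<partial>N) < 1"
    by (rule order_tendstoD) simp
  then obtain n where n: "(\<integral>\<^sup>+ x. ennreal ((norm (f x - fn n x))\<^sup>2) \<partial>N) < 1"
    by (auto simp: eventually_sequentially)
  have "integrable N (\<lambda>x. (norm (f x - fn n x))\<^sup>2)"
    using n by (intro integrableI_bounded) (auto intro: order_less_trans)
  then have "square_integrable N (\<lambda>x. f x - fn n x)"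
    by (simp add: square_integrable_def)
  from square_integrable_add[OF this fn[of n]] show ?thesis
    by simp
qed

text \<open>
  Writing \<open>fn \<bullet> gn - f \<bullet> g\<close> in terms of \<open>f\<close>, \<open>g\<close> and the two differences avoids a uniform bound on
  the norms of the approximations.
\<close>

lemma L2_limit_inner:
  assumes f: "L2_limit N fn f" and g: "L2_limit N gn g"
  shows "(\<lambda>n. \<integral>x. fn n x \<bullet> gn n x \<partial>N) \<longlonglongrightarrow> (\<integral>x. f x \<bullet> g x \<partial>N)"
proof -
  have sq: "square_integrable N f" "square_integrable N g"
      "\<And>n. square_integrable N (fn n)" "\<And>n. square_integrable N (gn n)"
    using f g L2_limit_square_integrable by (auto simp: L2_limit_def)
  define l2 where "l2 h = sqrt (\<integral>x. (norm (h x))\<^sup>2 \<partial>N)" for h :: "'a \<Rightarrow> 'b"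
  define df dg where "df n = (\<lambda>x. f x - fn n x)" and "dg n = (\<lambda>x. g x - gn n x)" for n
  have sqd: "square_integrable N (df n)" "square_integrable N (dg n)" for n
    using sq by (auto simp: df_def dg_def intro: square_integrable_diff)
  have to0: "(\<lambda>n. l2 (\<lambda>x. h x - hn n x)) \<longlonglongrightarrow> 0" if h: "L2_limit N hn h" for h hn
  proof -
    have "square_integrable N (\<lambda>x. h x - hn n x)" for n
      using h L2_limit_square_integrable[OF h] by (auto simp: L2_limit_def intro: square_integrable_diff)
    then have "(\<integral>\<^sup>+ x. ennreal ((norm (h x - hn n x))\<^sup>2) \<partial>N) = ennreal (\<integral>x. (norm (h x - hn n x))\<^sup>2 \<partial>N)" for n
      by (intro nn_integral_eq_integral) (auto simp: square_integrable_def)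
    then have "(\<lambda>n. ennreal (\<integral>x. (norm (h x - hn n x))\<^sup>2 \<partial>N)) \<longlonglongrightarrow> ennreal 0"
      using h by (simp add: L2_limit_def)
    then have "(\<lambda>n. \<integral>x. (norm (h x - hn n x))\<^sup>2 \<partial>N) \<longlonglongrightarrow> 0"
      by (subst (asm) tendsto_ennreal_iff) auto
    from tendsto_real_sqrt[OF this] show ?thesis
      by (simp add: l2_def)
  qed
  have df0: "(\<lambda>n. l2 (df n)) \<longlonglongrightarrow> 0" and dg0: "(\<lambda>n. l2 (dg n)) \<longlonglongrightarrow> 0"
    using to0[OF f] to0[OF g] by (auto simp: df_def dg_def)
  have "(\<lambda>n. l2 f * l2 (dg n) + l2 (df n) * l2 g + l2 (df n) * l2 (dg n)) \<longlonglongrightarrow>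
      l2 f * 0 + 0 * l2 g + 0 * 0"
    by (intro tendsto_intros df0 dg0)
  then have lim: "(\<lambda>n. l2 f * l2 (dg n) + l2 (df n) * l2 g + l2 (df n) * l2 (dg n)) \<longlonglongrightarrow> 0"
    by simp
  have bound: "norm ((\<integral>x. fn n x \<bullet> gn n x \<partial>N) - (\<integral>x. f x \<bullet> g x \<partial>N))
      \<le> l2 f * l2 (dg n) + l2 (df n) * l2 g + l2 (df n) * l2 (dg n)" for n
  proof -
    have "(\<integral>x. fn n x \<bullet> gn n x \<partial>N) =
        (\<integral>x. f x \<bullet> g x - f x \<bullet> dg n x - df n x \<bullet> g x + df n x \<bullet> dg n x \<partial>N)"
      by (intro Bochner_Integration.integral_cong)
        (auto simp: df_def dg_def inner_diff algebra_simps)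
    also have "\<dots> = (\<integral>x. f x \<bullet> g x \<partial>N) - (\<integral>x. f x \<bullet> dg n x \<partial>N) - (\<integral>x. df n x \<bullet> g x \<partial>N)
        + (\<integral>x. df n x \<bullet> dg n x \<partial>N)"
      using sq sqd by (simp add: square_integrable_inner)
    finally show ?thesis
      using L2_Cauchy_Schwarz[OF sq(1) sqd(2)[of n]] L2_Cauchy_Schwarz[OF sqd(1)[of n] sq(2)]
        L2_Cauchy_Schwarz[OF sqd(1)[of n] sqd(2)[of n]]
      by (simp add: l2_def)
  qed
  have "(\<lambda>n. (\<integral>x. fn n x \<bullet> gn n x \<partial>N) - (\<integral>x. f x \<bullet> g x \<partial>N)) \<longlonglongrightarrow> 0"
    by (rule Lim_null_comparison[OF _ lim]) (use bound in auto)
  then show ?thesis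
    by (simp add: LIM_zero_iff)
qed

section \<open>Measurability of vector- and operator-valued functions\<close>

lemma countable_dense_subset:
  obtains D :: "'a::second_countable_topology set" where "countable D" "closure D = UNIV"
proof -
  obtain D :: "'a set" where D: "countable D" "\<And>X. open X \<Longrightarrow> X \<noteq> {} \<Longrightarrow> \<exists>d\<in>D. d \<in> X"
    using countable_dense_exists by blast
  have "closure D = UNIV"
    using D(2)[of "- closure D"] closure_subset[of D] by auto
  then show thesis
    using D(1) that by blast
qed

text \<open>
  Pettis' theorem for separable Hilbert spaces: the norm is a supremum over countably many linear
  functionals, so the preimages of balls are measurable, and every open set is a countable union of
  balls.  It is what makes adjoints of strongly measurable operator functions strongly measurable.
\<close>

lemma weakly_measurable_imp_measurable:
  fixes f :: "'a \<Rightarrow> 'h::{real_inner, second_countable_topology}"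
  assumes weak: "\<And>y. (\<lambda>x. f x \<bullet> y) \<in> borel_measurable N"
  shows "f \<in> borel_measurable N"
proof (rule borel_measurableI)
  note [measurable] = weak
  obtain D :: "'h set" where D: "countable D" "closure D = UNIV"
    using countable_dense_subset by blast
  have dist_le: "{x \<in> space N. norm (f x - c) \<le> a} \<in> sets N" for a c
  proof (cases "0 \<le> a")
    case True
    have "norm v \<le> a \<longleftrightarrow> (\<forall>d\<in>D. v \<bullet> d \<le> a * norm d)" for v :: 'h
    proof safe
      fix d
      assume "norm v \<le> a"
      have "v \<bullet> d \<le> norm v * norm d"
        by (rule norm_cauchy_schwarz)
      also have "\<dots> \<le> a * norm d"
        using \<open>norm v \<le> a\<close> by (rule mult_right_mono) simp
      finally show "v \<bullet> d \<le> a * norm d" .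
    next
      assume "\<forall>d\<in>D. v \<bullet> d \<le> a * norm d"
      then have "closure D \<subseteq> {u. v \<bullet> u \<le> a * norm u}"
        by (intro closure_minimal closed_Collect_le continuous_intros) auto
      then have "v \<bullet> v \<le> a * norm v"
        using D(2) by auto
      then show "norm v \<le> a"
        using True by (cases "v = 0") (auto simp: power2_norm_eq_inner[symmetric] power2_eq_square)
    qed
    then have "{x \<in> space N. norm (f x - c) \<le> a} =
        {x \<in> space N. \<forall>d\<in>D. f x \<bullet> d - c \<bullet> d \<le> a * norm d}"
      by (simp add: inner_diff_left)
    also have "\<dots> \<in> sets N"
      using D(1) by measurable
    finally show ?thesis .
  next
    case False
    then have "{x \<in> space N. norm (f x - c) \<le> a} = {}"
      by (auto intro: order_trans[OF norm_ge_zero])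
    then show ?thesis
      by (metis sets.empty_sets)
  qed
  then have [measurable]: "(\<lambda>x. norm (f x - c)) \<in> borel_measurable N" for c
    by (auto simp: borel_measurable_iff_le)
  fix S :: "'h set"
  assume S: "open S"
  define \<B> where "\<B> = {ball c r | c r. ball c r \<subseteq> S}"
  obtain \<B>' where B': "\<B>' \<subseteq> \<B>" "countable \<B>'" "\<Union>\<B>' = \<Union>\<B>"
    by (rule Lindelof[of \<B>]) (auto simp: \<B>_def)
  have "\<Union>\<B> = S"
  proof
    show "S \<subseteq> \<Union>\<B>"
    proof
      fix x assume "x \<in> S"
      then obtain r where "0 < r" "ball x r \<subseteq> S"
        using S openE by blast
      then show "x \<in> \<Union>\<B>"
        by (auto simp: \<B>_def intro!: exI[of _ "ball x r"])
    qed
  qed (auto simp: \<B>_def)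
  then have "f -` S \<inter> space N = (\<Union>U\<in>\<B>'. f -` U \<inter> space N)"
    unfolding B'(3)[unfolded \<open>\<Union>\<B> = S\<close>, symmetric] by auto
  also have "\<dots> \<in> sets N"
  proof (rule sets.countable_UN'')
    fix U assume "U \<in> \<B>'"
    then obtain c r where "U = ball c r"
      using B'(1) by (auto simp: \<B>_def)
    then have "f -` U \<inter> space N = {x \<in> space N. norm (f x - c) < r}"
      by (auto simp: dist_norm norm_minus_commute)
    then show "f -` U \<inter> space N \<in> sets N"
      by simp
  qed fact
  finally show "f -` S \<inter> space N \<in> sets N" .
qed

lemma measurable_norm_blinfun:
  fixes K :: "'a \<Rightarrow> ('h::{real_normed_vector, second_countable_topology} \<Rightarrow>\<^sub>L 'h)"
  assumes [measurable]: "\<And>u. (\<lambda>x. K x u) \<in> borel_measurable N"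
  shows "(\<lambda>x. norm (K x)) \<in> borel_measurable N"
  unfolding borel_measurable_iff_le
proof
  fix a :: real
  obtain D :: "'h set" where D: "countable D" "closure D = UNIV"
    using countable_dense_subset by blast
  show "{x \<in> space N. norm (K x) \<le> a} \<in> sets N"
  proof (cases "0 \<le> a")
    case True
    have "norm L \<le> a \<longleftrightarrow> (\<forall>d\<in>D. norm (blinfun_apply L d) \<le> a * norm d)" for L :: "'h \<Rightarrow>\<^sub>L 'h"
    proof safe
      fix d :: 'h
      assume "norm L \<le> a"
      then have "norm L * norm d \<le> a * norm d"
        by (rule mult_right_mono) simp
      then show "norm (L d) \<le> a * norm d"
        using norm_blinfun[of L d] by linarith
    next
      assume "\<forall>d\<in>D. norm (L d) \<le> a * norm d"
      then have "closure D \<subseteq> {u. norm (L u) \<le> a * norm u}"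
        by (intro closure_minimal closed_Collect_le continuous_intros) auto
      then have "norm (L u) \<le> a * norm u" for u
        using D(2) by auto
      then show "norm L \<le> a"
        using True by (intro norm_blinfun_bound) auto
    qed
    then have "{x \<in> space N. norm (K x) \<le> a} = {x \<in> space N. \<forall>d\<in>D. norm (K x d) \<le> a * norm d}"
      by simp
    also have "\<dots> \<in> sets N"
      using D(1) by measurable
    finally show ?thesis .
  next
    case False
    then have "{x \<in> space N. norm (K x) \<le> a} = {}"
      by (auto intro: order_trans[OF norm_ge_zero])
    then show ?thesis
      by (metis sets.empty_sets)
  qed
qed

lemma measurable_adjoint:
  fixes K :: "'a \<Rightarrow> ('h::{real_inner, banach, second_countable_topology} \<Rightarrow>\<^sub>L 'h)"
  assumes K: "\<And>u. (\<lambda>x. K x u) \<in> borel_measurable N"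
  shows "(\<lambda>x. adjoint (K x) y) \<in> borel_measurable N"
proof (rule weakly_measurable_imp_measurable)
  fix u
  have "(\<lambda>x. K x u \<bullet> y) \<in> borel_measurable N"
    by (intro borel_measurable_inner K borel_measurable_const)
  then show "(\<lambda>x. adjoint (K x) y \<bullet> u) \<in> borel_measurable N"
    by (simp add: inner_commute[of _ u] adjoint_works_Hilbert)
qed

lemma measurable_blinfun_apply:
  fixes K :: "'a \<Rightarrow> ('h::{real_inner, banach, second_countable_topology} \<Rightarrow>\<^sub>L 'h)"
  assumes K: "\<And>u. (\<lambda>x. K x u) \<in> borel_measurable N" and v: "v \<in> borel_measurable N"
  shows "(\<lambda>x. K x (v x)) \<in> borel_measurable N"
proof (rule weakly_measurable_imp_measurable)
  fix y
  have "(\<lambda>x. v x \<bullet> adjoint (K x) y) \<in> borel_measurable N"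
    by (intro borel_measurable_inner v measurable_adjoint K)
  then show "(\<lambda>x. K x (v x) \<bullet> y) \<in> borel_measurable N"
    by (simp add: adjoint_works_Hilbert)
qed

lemma measurable_blinfun_apply_const:
  fixes L :: "'h::{real_inner, banach, second_countable_topology} \<Rightarrow>\<^sub>L 'h"
  shows "v \<in> borel_measurable N \<Longrightarrow> (\<lambda>x. L (v x)) \<in> borel_measurable N"
  by (rule measurable_blinfun_apply[of "\<lambda>_. L"]) simp_all

section \<open>Covariance of the increments of a cylindrical Wiener process\<close>

context prob_space begin

lemma centered_normal_moments:
  assumes "centered_normal M v X"
  shows "X \<in> borel_measurable M" "integrable M X" "integrable M (\<lambda>\<omega>. (X \<omega>)\<^sup>2)"
    "expectation X = 0" "expectation (\<lambda>\<omega>. (X \<omega>)\<^sup>2) = v"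
proof -
  have "X \<in> borel_measurable M \<and> integrable M X \<and> integrable M (\<lambda>\<omega>. (X \<omega>)\<^sup>2) \<and>
    expectation X = 0 \<and> expectation (\<lambda>\<omega>. (X \<omega>)\<^sup>2) = v"
  proof (cases "v = 0")
    case True
    then have X: "X \<in> borel_measurable M" and ae: "AE \<omega> in M. X \<omega> = 0"
      using assms by (auto simp: centered_normal_def)
    have "AE \<omega> in M. (X \<omega>)\<^sup>2 = 0"
      using ae by eventually_elim simp
    then show ?thesis
      using True X ae integrable_cong_AE[of X M "\<lambda>_. 0"] integral_cong_AE[of X M "\<lambda>_. 0"]
        integrable_cong_AE[of "\<lambda>\<omega>. (X \<omega>)\<^sup>2" M "\<lambda>_. 0"] integral_cong_AE[of "\<lambda>\<omega>. (X \<omega>)\<^sup>2" M "\<lambda>_. 0"]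
      by simp
  next
    case False
    then have v: "0 < v" and D: "distributed M lborel X (normal_density 0 (sqrt v))"
      using assms by (auto simp: centered_normal_def)
    have mean: "expectation X = 0"
      using normal_distributed_expectation[OF _ D] v by simp
    have "expectation (\<lambda>\<omega>. (X \<omega>)\<^sup>2) = v"
      using normal_distributed_variance[OF _ D] v mean by simp
    moreover have "integrable M (\<lambda>\<omega>. (X \<omega>)\<^sup>2)"
      using distributed_integrable[OF D, of "\<lambda>x. x\<^sup>2"] integrable_normal_moment[of "sqrt v" 0 2] v by simp
    moreover have "integrable M X"
      using distributed_integrable[OF D, of "\<lambda>x. x"] integrable_normal_moment[of "sqrt v" 0 1] v by simp
    ultimately show ?thesis
      using mean distributed_measurable[OF D] by simp
  qed
  then show "X \<in> borel_measurable M" "integrable M X" "integrable M (\<lambda>\<omega>. (X \<omega>)\<^sup>2)"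
    "expectation X = 0" "expectation (\<lambda>\<omega>. (X \<omega>)\<^sup>2) = v"
    by auto
qed

text \<open>
  The past is \<open>G\<close>: it determines \<open>X\<close> and is independent of the increment \<open>Y\<close>.
\<close>

lemma expectation_mult_indep_centered:
  fixes X Y :: "'a \<Rightarrow> real"
  assumes indep: "indep_set (sets G) (sets (vimage_algebra (space M) Y borel))"
    and G: "subalgebra M G" and XG: "X \<in> borel_measurable G"
    and X: "integrable M X" and Y: "integrable M Y" "expectation Y = 0"
  shows "integrable M (\<lambda>\<omega>. X \<omega> * Y \<omega>)" "expectation (\<lambda>\<omega>. X \<omega> * Y \<omega>) = 0"
proof -
  have "{X -` A \<inter> space M |A. A \<in> sets borel} \<subseteq> sets G"
    using XG G by (auto simp: measurable_def subalgebra_def)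
  then have "sigma_sets (space M) {X -` A \<inter> space M |A. A \<in> sets borel} \<subseteq> sets G"
    using sets.sigma_sets_subset[of _ G] G by (simp add: subalgebra_def)
  moreover have "sigma_sets (space M) {Y -` A \<inter> space M |A. A \<in> sets borel} =
      sets (vimage_algebra (space M) Y borel)"
    by (simp add: sets_vimage_algebra)
  ultimately have "indep_set (sigma_sets (space M) {X -` A \<inter> space M |A. A \<in> sets borel})
      (sigma_sets (space M) {Y -` A \<inter> space M |A. A \<in> sets borel})"
    using indep unfolding indep_set_def
    by (elim indep_sets_mono_sets) (auto split: bool.splits)
  then have iv: "indep_var borel X borel Y"
    unfolding indep_var_eq using X Y(1) by auto
  show "integrable M (\<lambda>\<omega>. X \<omega> * Y \<omega>)"
    by (rule indep_var_integrable[OF iv X Y(1)])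
  show "expectation (\<lambda>\<omega>. X \<omega> * Y \<omega>) = 0"
    using indep_var_lebesgue_integral[OF iv X Y(1)] Y(2) by simp
qed

end

locale wiener_process = prob_space M
  for M :: "'w measure" and F :: "real \<Rightarrow> 'w measure"
    and Q :: "'h::{real_inner, banach, second_countable_topology} \<Rightarrow>\<^sub>L 'h"
    and W :: "real \<Rightarrow> 'h \<Rightarrow> 'w \<Rightarrow> real" +
  assumes filtration: "normal_filtration M F"
    and sa: "self_adjoint_op Q"
    and wiener: "cylindrical_wiener M F Q W"
begin

lemma subalgebra_filtration: "0 \<le> t \<Longrightarrow> subalgebra M (F t)"
  using filtration by (simp add: normal_filtration_def)

lemma W_adapted: "0 \<le> t \<Longrightarrow> W t x \<in> borel_measurable (F t)"
  using wiener by (simp add: cylindrical_wiener_def brownian_motion_def)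

lemma W_measurable: "0 \<le> t \<Longrightarrow> W t x \<in> borel_measurable M"
  using measurable_from_subalg[OF subalgebra_filtration W_adapted] by blast

lemma W_increment:
  assumes "0 \<le> s" "s < t"
  shows "centered_normal M ((t - s) * (Q x \<bullet> x)) (\<lambda>\<omega>. W t x \<omega> - W s x \<omega>)"
    "indep_set (sets (F s)) (sets (vimage_algebra (space M) (\<lambda>\<omega>. W t x \<omega> - W s x \<omega>) borel))"
  using wiener assms by (auto simp: cylindrical_wiener_def brownian_motion_def)

lemma W_zero: "AE \<omega> in M. W 0 x \<omega> = 0"
  using wiener by (simp add: cylindrical_wiener_def brownian_motion_def)

lemma W_linear: "0 \<le> t \<Longrightarrow> AE \<omega> in M. W t (a *\<^sub>R x + b *\<^sub>R y) \<omega> = a * W t x \<omega> + b * W t y \<omega>"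
  using wiener by (simp add: cylindrical_wiener_def)

text \<open>
  The value at time \<open>t\<close> is the increment from time 0, up to a null set.
\<close>

lemma W_moments:
  assumes t: "0 \<le> t"
  shows "integrable M (W t x)" "integrable M (\<lambda>\<omega>. (W t x \<omega>)\<^sup>2)" "expectation (W t x) = 0"
    "expectation (\<lambda>\<omega>. (W t x \<omega>)\<^sup>2) = t * (Q x \<bullet> x)"
proof -
  have "centered_normal M (t * (Q x \<bullet> x)) (W t x)"
  proof (cases "t = 0")
    case True
    then show ?thesis
      using W_zero W_measurable[of 0] by (simp add: centered_normal_def)
  next
    case False
    have ae: "AE \<omega> in M. W t x \<omega> - W 0 x \<omega> = W t x \<omega>"
      using W_zero[of x] by eventually_elim simp
    have "distr M lborel (\<lambda>\<omega>. W t x \<omega> - W 0 x \<omega>) = distr M lborel (W t x)"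
      using W_measurable[OF t, of x] W_measurable[of 0 x] ae by (intro distr_cong_AE) auto
    then show ?thesis
      using W_increment(1)[of 0 t x] t False W_measurable[OF t, of x] ae
      by (auto simp: centered_normal_def distributed_def split: if_splits elim: eventually_elim2)
  qed
  from centered_normal_moments[OF this]
  show "integrable M (W t x)" "integrable M (\<lambda>\<omega>. (W t x \<omega>)\<^sup>2)" "expectation (W t x) = 0"
    "expectation (\<lambda>\<omega>. (W t x \<omega>)\<^sup>2) = t * (Q x \<bullet> x)"
    by auto
qed

lemma Q_symmetric: "Q x \<bullet> y = Q y \<bullet> x"
  using sa by (metis self_adjoint_op_def inner_commute)

text \<open>
  Polarisation of the variance, which is known for all directions.
\<close>

lemma W_covariance_same_time:
  assumes t: "0 \<le> t"
  shows "has_bochner_integral M (\<lambda>\<omega>. W t x \<omega> * W t y \<omega>) (t * (Q x \<bullet> y))"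
proof -
  note [measurable] = W_measurable[OF t]
  have ae: "AE \<omega> in M. (W t (x + y) \<omega>)\<^sup>2 - (W t x \<omega>)\<^sup>2 - (W t y \<omega>)\<^sup>2 = 2 * (W t x \<omega> * W t y \<omega>)"
    using W_linear[OF t, of 1 x 1 y] by eventually_elim (simp add: power2_sum)
  have "has_bochner_integral M (\<lambda>\<omega>. (W t z \<omega>)\<^sup>2) (t * (Q z \<bullet> z))" for z
    using W_moments[OF t, of z] by (simp add: has_bochner_integral_iff)
  then have "has_bochner_integral M (\<lambda>\<omega>. (W t (x + y) \<omega>)\<^sup>2 - (W t x \<omega>)\<^sup>2 - (W t y \<omega>)\<^sup>2)
      (t * (Q (x + y) \<bullet> (x + y)) - t * (Q x \<bullet> x) - t * (Q y \<bullet> y))"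
    by (intro has_bochner_integral_diff)
  also have "t * (Q (x + y) \<bullet> (x + y)) - t * (Q x \<bullet> x) - t * (Q y \<bullet> y) = 2 * (t * (Q x \<bullet> y))"
    by (simp add: blinfun.bilinear_simps inner_add Q_symmetric[of y x] algebra_simps)
  finally have "has_bochner_integral M (\<lambda>\<omega>. 2 * (W t x \<omega> * W t y \<omega>)) (2 * (t * (Q x \<bullet> y)))"
    by (rule has_bochner_integralI_AE[OF _ _ ae]) measurable
  from has_bochner_integral_mult_right[OF this, of "1/2"] show ?thesis
    by simp
qed

text \<open>
  Split \<open>W t y\<close> at time \<open>s\<close>: the increment after \<open>s\<close> is independent of \<open>W s x\<close> and centred.
\<close>

lemma W_covariance_ordered:
  assumes st: "0 \<le> s" "s \<le> t"
  shows "has_bochner_integral M (\<lambda>\<omega>. W s x \<omega> * W t y \<omega>) (s * (Q x \<bullet> y))"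
proof (cases "s = t")
  case True
  then show ?thesis
    using W_covariance_same_time st by simp
next
  case False
  then have less: "s < t"
    using st by simp
  note N = centered_normal_moments[OF W_increment(1)[OF st(1) less, of y]]
  have "has_bochner_integral M (\<lambda>\<omega>. W s x \<omega> * (W t y \<omega> - W s y \<omega>)) 0"
    using expectation_mult_indep_centered[OF W_increment(2)[OF st(1) less] subalgebra_filtration[OF st(1)]
        W_adapted[OF st(1)] W_moments(1)[OF st(1)] N(2,4)]
    by (simp add: has_bochner_integral_iff)
  from has_bochner_integral_add[OF this W_covariance_same_time[OF st(1), of x y]] show ?thesis
    by (simp add: algebra_simps)
qed

lemma W_covariance:
  assumes "0 \<le> s" "0 \<le> t"
  shows "has_bochner_integral M (\<lambda>\<omega>. W s x \<omega> * W t y \<omega>) (min s t * (Q x \<bullet> y))"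
proof (cases "s \<le> t")
  case True
  then show ?thesis
    using W_covariance_ordered[of s t x y] assms by simp
next
  case False
  then show ?thesis
    using W_covariance_ordered[of t s y x] assms by (simp add: mult.commute Q_symmetric)
qed

lemma W_increment_covariance:
  assumes ab: "0 \<le> a" "a \<le> b" and cd: "0 \<le> c" "c \<le> d"
  shows "has_bochner_integral M (\<lambda>\<omega>. (W b x \<omega> - W a x \<omega>) * (W d y \<omega> - W c y \<omega>))
    (measure lborel ({a<..b} \<inter> {c<..d}) * (Q x \<bullet> y))"
proof -
  have "has_bochner_integral M
      (\<lambda>\<omega>. W b x \<omega> * W d y \<omega> - W b x \<omega> * W c y \<omega> - (W a x \<omega> * W d y \<omega> - W a x \<omega> * W c y \<omega>))
      (min b d * (Q x \<bullet> y) - min b c * (Q x \<bullet> y) - (min a d * (Q x \<bullet> y) - min a c * (Q x \<bullet> y)))"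
    using ab cd by (intro has_bochner_integral_diff W_covariance) auto
  also have "(\<lambda>\<omega>. W b x \<omega> * W d y \<omega> - W b x \<omega> * W c y \<omega> - (W a x \<omega> * W d y \<omega> - W a x \<omega> * W c y \<omega>)) =
      (\<lambda>\<omega>. (W b x \<omega> - W a x \<omega>) * (W d y \<omega> - W c y \<omega>))"
    by (simp add: algebra_simps)
  also have "min b d * (Q x \<bullet> y) - min b c * (Q x \<bullet> y) - (min a d * (Q x \<bullet> y) - min a c * (Q x \<bullet> y)) =
      measure lborel ({a<..b} \<inter> {c<..d}) * (Q x \<bullet> y)"
  proof -
    have "measure lborel ({a<..b} \<inter> {c<..d}) = min b d - min b c - (min a d - min a c)"
      using ab cd by (auto simp: min_def max_def measure_def)
    then show ?thesis
      by (simp only: left_diff_distrib)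
  qed
  finally show ?thesis .
qed

end

section \<open>The Ito isometry for elementary integrands\<close>

lemma elementary_on_simps [simp]:
  "elementary_on t []"
  "elementary_on t ((a, b, x, h) # E) \<longleftrightarrow> 0 \<le> a \<and> a \<le> b \<and> b \<le> t \<and> elementary_on t E"
  by (auto simp: elementary_on_def)

lemma elementary_fun_simps [simp]:
  "elementary_fun [] r = 0"
  "elementary_fun ((a, b, x, h) # E) r =
     indicat_real {a<..b} r *\<^sub>R (blinfun_scaleR_left h o\<^sub>L blinfun_inner_right x) + elementary_fun E r"
  by (auto simp: elementary_fun_def)

lemma elementary_integral_simps [simp]:
  "elementary_integral W [] \<omega> = 0"
  "elementary_integral W ((a, b, x, h) # E) \<omega> =
     (W b x \<omega> - W a x \<omega>) *\<^sub>R h + elementary_integral W E \<omega>"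
  by (auto simp: elementary_integral_def)

lemma elementary_fun_outside:
  "elementary_on t E \<Longrightarrow> r \<notin> {0..t} \<Longrightarrow> elementary_fun E r = 0"
  by (induction E) (auto simp: indicator_def)

lemma adjoint_rank_one:
  fixes x h :: "'h::{real_inner, banach}"
  shows "adjoint (blinfun_scaleR_left h o\<^sub>L blinfun_inner_right x) y = (h \<bullet> y) *\<^sub>R x"
  by (rule adjoint_eqI) (simp add: inner_commute mult.commute)

lemma elementary_fun_measurable:
  "(\<lambda>r. elementary_fun E r u) \<in> borel_measurable lborel"
  for u :: "'h::{real_inner, banach, second_countable_topology}"
proof (induction E)
  case (Cons p E)
  obtain a b x h where "p = (a, b, x, h)"
    by (cases p)
  then show ?case
    using Cons by (simp add: blinfun.bilinear_simps)
qed simp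

text \<open>
  Elementary integrands are bounded with bounded support.
\<close>

lemma square_integrable_elementary_fun:
  fixes R :: "'h::{real_inner, banach, second_countable_topology} \<Rightarrow>\<^sub>L 'h"
  shows "square_integrable lborel (\<lambda>r. norm (elementary_fun E r o\<^sub>L R))"
proof (induction E)
  case Nil
  show ?case
    by (simp add: square_integrable_def)
next
  case (Cons p E)
  obtain a b x h where p: "p = (a, b, x, h)"
    by (cases p)
  define K where "K = blinfun_scaleR_left h o\<^sub>L blinfun_inner_right x"
  have "(norm (indicat_real {a<..b} r))\<^sup>2 = indicat_real {a<..b} r" for r
    by (simp add: indicator_def)
  moreover have "integrable lborel (indicat_real {a<..b})"
    by (intro integrable_real_indicator emeasure_bounded_finite bounded_subset[OF bounded_closed_interval[of a b]]) auto
  ultimately have "square_integrable lborel (indicat_real {a<..b})"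
    by (simp add: square_integrable_def)
  from square_integrable_add[OF square_integrable_scaleR[OF this, of "norm (K o\<^sub>L R)"] Cons]
  show ?case
  proof (rule square_integrable_bound)
    show "(\<lambda>r. norm (elementary_fun (p # E) r o\<^sub>L R)) \<in> borel_measurable lborel"
      by (intro measurable_norm_blinfun)
        (simp only: blinfun_apply_blinfun_compose elementary_fun_measurable)
    fix r
    have "elementary_fun (p # E) r o\<^sub>L R =
        indicat_real {a<..b} r *\<^sub>R (K o\<^sub>L R) + (elementary_fun E r o\<^sub>L R)"
      by (rule blinfun_eqI) (simp add: p K_def blinfun.bilinear_simps)
    then have "norm (elementary_fun (p # E) r o\<^sub>L R)
        \<le> norm (K o\<^sub>L R) * indicat_real {a<..b} r + norm (elementary_fun E r o\<^sub>L R)"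
      using norm_triangle_ineq[of "indicat_real {a<..b} r *\<^sub>R (K o\<^sub>L R)" "elementary_fun E r o\<^sub>L R"]
      by (simp add: mult.commute)
    then show "norm (norm (elementary_fun (p # E) r o\<^sub>L R))
        \<le> norm (norm (K o\<^sub>L R) *\<^sub>R indicat_real {a<..b} r + norm (elementary_fun E r o\<^sub>L R))"
      by simp
  qed
qed

context wiener_process
begin

text \<open>
  The common value \<open>c\<close> is existentially quantified so that the property is preserved under addition
  in either integrand, integrability included.
\<close>

definition elementary_isometric where
  "elementary_isometric E E' y z \<longleftrightarrow> (\<exists>c.
     has_bochner_integral M (\<lambda>\<omega>. (elementary_integral W E \<omega> \<bullet> y) * (elementary_integral W E' \<omega> \<bullet> z)) c \<and>
     has_bochner_integral lborel
       (\<lambda>r. Q (adjoint (elementary_fun E r) y) \<bullet> adjoint (elementary_fun E' r) z) c)"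

lemma elementary_isometric_add:
  assumes "elementary_isometric E1 E1' y z" "elementary_isometric E2 E2' y z"
    and "\<And>\<omega>. (elementary_integral W E \<omega> \<bullet> y) * (elementary_integral W E' \<omega> \<bullet> z) =
      (elementary_integral W E1 \<omega> \<bullet> y) * (elementary_integral W E1' \<omega> \<bullet> z) +
      (elementary_integral W E2 \<omega> \<bullet> y) * (elementary_integral W E2' \<omega> \<bullet> z)"
    and "\<And>r. Q (adjoint (elementary_fun E r) y) \<bullet> adjoint (elementary_fun E' r) z =
      Q (adjoint (elementary_fun E1 r) y) \<bullet> adjoint (elementary_fun E1' r) z +
      Q (adjoint (elementary_fun E2 r) y) \<bullet> adjoint (elementary_fun E2' r) z"
  shows "elementary_isometric E E' y z"
proof -
  obtain c1 where c1:
    "has_bochner_integral M (\<lambda>\<omega>. (elementary_integral W E1 \<omega> \<bullet> y) * (elementary_integral W E1' \<omega> \<bullet> z)) c1"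
    "has_bochner_integral lborel
       (\<lambda>r. Q (adjoint (elementary_fun E1 r) y) \<bullet> adjoint (elementary_fun E1' r) z) c1"
    using assms(1) unfolding elementary_isometric_def by (elim exE conjE)
  obtain c2 where c2:
    "has_bochner_integral M (\<lambda>\<omega>. (elementary_integral W E2 \<omega> \<bullet> y) * (elementary_integral W E2' \<omega> \<bullet> z)) c2"
    "has_bochner_integral lborel
       (\<lambda>r. Q (adjoint (elementary_fun E2 r) y) \<bullet> adjoint (elementary_fun E2' r) z) c2"
    using assms(2) unfolding elementary_isometric_def by (elim exE conjE)
  show ?thesis
    unfolding elementary_isometric_def assms(3,4)
    using has_bochner_integral_add[OF c1(1) c2(1)] has_bochner_integral_add[OF c1(2) c2(2)]
    by (intro exI[of _ "c1 + c2"] conjI)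
qed

text \<open>
  On single intervals the isometry is the covariance of two increments of \<open>W\<close>.
\<close>

lemma elementary_isometry_single:
  assumes "0 \<le> a" "a \<le> b" "0 \<le> c" "c \<le> d"
  shows "elementary_isometric [(a, b, x, h)] [(c, d, x', h')] y z"
  unfolding elementary_isometric_def
proof (intro exI conjI)
  define k where "k = (Q x \<bullet> x') * (h \<bullet> y) * (h' \<bullet> z)"
  define m where "m = measure lborel ({a<..b} \<inter> {c<..d})"
  show "has_bochner_integral M
      (\<lambda>\<omega>. (elementary_integral W [(a, b, x, h)] \<omega> \<bullet> y) * (elementary_integral W [(c, d, x', h')] \<omega> \<bullet> z))
      (m * k)"
    using has_bochner_integral_mult_left[OF W_increment_covariance[OF assms, of x x'], of "(h \<bullet> y) * (h' \<bullet> z)"]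
    unfolding m_def[symmetric] by (simp add: k_def mult_ac)
  have "emeasure lborel ({a<..b} \<inter> {c<..d}) < \<infinity>"
    by (intro emeasure_bounded_finite bounded_subset[OF bounded_closed_interval[of a b]]) auto
  then have "has_bochner_integral lborel (\<lambda>r. indicat_real ({a<..b} \<inter> {c<..d}) r *\<^sub>R k) (m *\<^sub>R k)"
    unfolding m_def by (intro has_bochner_integral_indicator) auto
  then have "has_bochner_integral lborel (\<lambda>r. indicat_real {a<..b} r * indicat_real {c<..d} r * k) (m * k)"
    by (simp only: indicator_inter_arith real_scaleR_def)
  then show "has_bochner_integral lborel
      (\<lambda>r. Q (adjoint (elementary_fun [(a, b, x, h)] r) y) \<bullet> adjoint (elementary_fun [(c, d, x', h')] r) z)
      (m * k)"
    by (simp add: adjoint_blinfun_simps adjoint_rank_one blinfun.bilinear_simps k_def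
        mult_ac)
qed

lemma elementary_isometry_Cons_left:
  assumes "elementary_isometric [p] E' y z" "elementary_isometric E E' y z"
  shows "elementary_isometric (p # E) E' y z"
  using assms
  by (rule elementary_isometric_add)
    (cases p; simp add: adjoint_blinfun_simps blinfun.bilinear_simps inner_add distrib_right)+

lemma elementary_isometry_Cons_right:
  assumes "elementary_isometric E [p] y z" "elementary_isometric E E' y z"
  shows "elementary_isometric E (p # E') y z"
  using assms
  by (rule elementary_isometric_add)
    (cases p; simp add: adjoint_blinfun_simps inner_add distrib_left)+

lemma elementary_isometry:
  assumes "elementary_on s E" "elementary_on t E'"
  shows "elementary_isometric E E' y z"
proof -
  have trivial: "elementary_isometric [] E' y z" "elementary_isometric E [] y z" for E E'
    by (auto simp: elementary_isometric_def adjoint_blinfun_simps intro!: exI[of _ 0] has_bochner_integral_zero)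
  have single: "elementary_isometric [(a, b, x, h)] E' y z" if "0 \<le> a" "a \<le> b" for a b x h
    using assms(2)
  proof (induction E')
    case (Cons p E')
    obtain c d x' h' where p: "p = (c, d, x', h')"
      by (cases p)
    show ?case
    proof (rule elementary_isometry_Cons_right)
      show "elementary_isometric [(a, b, x, h)] [p] y z"
        using Cons.prems that by (simp add: p elementary_isometry_single)
      show "elementary_isometric [(a, b, x, h)] E' y z"
        using Cons by (simp add: p)
    qed
  qed (rule trivial)
  show ?thesis
    using assms(1)
  proof (induction E)
    case (Cons p E)
    obtain a b x h where p: "p = (a, b, x, h)"
      by (cases p)
    show ?case
    proof (rule elementary_isometry_Cons_left)
      show "elementary_isometric [p] E' y z"
        using Cons.prems by (simp add: p single)
      show "elementary_isometric E E' y z"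
        using Cons by (simp add: p)
    qed
  qed (rule trivial)
qed

lemma elementary_covariance:
  assumes "elementary_on s E" "elementary_on t E'"
  shows "integrable M (\<lambda>\<omega>. (elementary_integral W E \<omega> \<bullet> y) * (elementary_integral W E' \<omega> \<bullet> z))"
    "(\<integral>\<omega>. (elementary_integral W E \<omega> \<bullet> y) * (elementary_integral W E' \<omega> \<bullet> z) \<partial>M) =
     (\<integral>r. Q (adjoint (elementary_fun E r) y) \<bullet> adjoint (elementary_fun E' r) z \<partial>lborel)"
  using elementary_isometry[OF assms, of y z]
  by (auto simp: elementary_isometric_def has_bochner_integral_iff)

lemma elementary_integral_measurable:
  "elementary_on t E \<Longrightarrow> elementary_integral W E \<in> borel_measurable M"
proof (induction E)
  case (Cons p E)
  obtain a b x h where p: "p = (a, b, x, h)"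
    by (cases p)
  then have "W a x \<in> borel_measurable M" "W b x \<in> borel_measurable M"
    "elementary_integral W E \<in> borel_measurable M"
    using Cons by (auto intro!: W_measurable)
  then have "(\<lambda>\<omega>. (W b x \<omega> - W a x \<omega>) *\<^sub>R h + elementary_integral W E \<omega>) \<in> borel_measurable M"
    by measurable
  then show ?case
    by (simp add: p cong: measurable_cong)
qed (simp add: elementary_integral_def cong: measurable_cong)

lemma elementary_integral_mean_zero:
  assumes "elementary_on t E"
  shows "integrable M (\<lambda>\<omega>. elementary_integral W E \<omega> \<bullet> y) \<and> expectation (\<lambda>\<omega>. elementary_integral W E \<omega> \<bullet> y) = 0"
  using assms
proof (induction E)
  case (Cons p E)
  obtain a b x h where p: "p = (a, b, x, h)"
    by (cases p)
  then have "0 \<le> a" "0 \<le> b"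
    using Cons.prems by auto
  then show ?case
    using Cons p by (simp add: inner_add_left W_moments)
qed simp

lemma square_integrable_elementary_integral:
  assumes "elementary_on t E"
  shows "square_integrable M (\<lambda>\<omega>. elementary_integral W E \<omega> \<bullet> y)"
  unfolding square_integrable_def
proof
  note [measurable] = elementary_integral_measurable[OF assms]
  show "(\<lambda>\<omega>. elementary_integral W E \<omega> \<bullet> y) \<in> borel_measurable M"
    by measurable
  show "integrable M (\<lambda>\<omega>. (norm (elementary_integral W E \<omega> \<bullet> y))\<^sup>2)"
    using elementary_covariance(1)[OF assms assms, of y y] by (simp add: power2_eq_square)
qed

end

section \<open>Covariance of stochastic integrals\<close>

text \<open>
  Extension by zero from \<open>[0, t]\<close>, so that integrands with different horizons can be compared on
  the whole line.
\<close>

definition restrict_op :: "real \<Rightarrow> (real \<Rightarrow> ('h::real_normed_vector \<Rightarrow>\<^sub>L 'h)) \<Rightarrow> real \<Rightarrow> ('h \<Rightarrow>\<^sub>L 'h)" where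
  "restrict_op t \<Phi> r = indicat_real {0..t} r *\<^sub>R \<Phi> r"

locale coercive_wiener_process = wiener_process M F Q W
  for M :: "'w measure" and F :: "real \<Rightarrow> 'w measure"
    and Q :: "'h::{real_inner, banach, second_countable_topology} \<Rightarrow>\<^sub>L 'h"
    and W :: "real \<Rightarrow> 'h \<Rightarrow> 'w \<Rightarrow> real" +
  assumes coercive: "strictly_positive_op Q"
begin

abbreviation R where "R \<equiv> sqrt_op Q"

lemma R_self_adjoint: "self_adjoint_op R"
  by (rule sqrt_op_of_coercive(1)[OF sa coercive])

lemma R_R: "R (R x) = Q x"
  using sqrt_op_of_coercive(2)[OF sa coercive] by (metis blinfun_apply_blinfun_compose)

lemma R_inner: "R x \<bullet> R y = Q x \<bullet> y"
  using R_self_adjoint by (metis R_R self_adjoint_op_def)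

text \<open>
  All \<open>L\<^sup>2\<close> limits follow from the two limits that define the stochastic integral.  The operator
  norm is used in between because, unlike the Hilbert--Schmidt norm, it is easily seen to be
  measurable in \<open>r\<close>.
\<close>

lemma stoch_integral_approximation:
  assumes I: "stoch_integral M Q W t \<Phi> I"
  obtains E where "\<And>n. elementary_on t (E n)"
    "L2_limit lborel (\<lambda>n r. norm (elementary_fun (E n) r o\<^sub>L R)) (\<lambda>r. norm (restrict_op t \<Phi> r o\<^sub>L R))"
    "\<And>y. L2_limit lborel (\<lambda>n r. R (adjoint (elementary_fun (E n) r) y)) (\<lambda>r. R (adjoint (restrict_op t \<Phi> r) y))"
    "\<And>y. L2_limit M (\<lambda>n \<omega>. elementary_integral W (E n) \<omega> \<bullet> y) (\<lambda>\<omega>. I \<omega> \<bullet> y)"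
    "\<And>u. (\<lambda>r. restrict_op t \<Phi> r u) \<in> borel_measurable lborel"
proof -
  obtain E where E: "\<And>n. elementary_on t (E n)"
    and hs: "(\<lambda>n. \<integral>\<^sup>+ r\<in>{0..t}. hs_norm_sq ((\<Phi> r - elementary_fun (E n) r) o\<^sub>L R) \<partial>lborel) \<longlonglongrightarrow> 0"
    and ms: "(\<lambda>n. \<integral>\<^sup>+ \<omega>. ennreal ((norm (I \<omega> - elementary_integral W (E n) \<omega>))\<^sup>2) \<partial>M) \<longlonglongrightarrow> 0"
    using I unfolding stoch_integral_def by blast
  have [measurable]: "I \<in> borel_measurable M"
    using I by (simp add: stoch_integral_def)
  note [measurable] = elementary_integral_measurable[OF E]
  define \<Psi> where "\<Psi> = restrict_op t \<Phi>"
  have meas: "(\<lambda>r. \<Psi> r u) \<in> borel_measurable lborel" for u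
    using I by (simp add: stoch_integral_def set_borel_measurable_def \<Psi>_def restrict_op_def
        blinfun.bilinear_simps)
  define g where "g n r = norm ((\<Psi> r - elementary_fun (E n) r) o\<^sub>L R)" for n r
  have g_meas: "g n \<in> borel_measurable lborel" for n
    unfolding g_def
    by (intro measurable_norm_blinfun)
      (simp only: blinfun_apply_blinfun_compose blinfun.diff_left borel_measurable_diff meas elementary_fun_measurable)
  have g_lim: "(\<lambda>n. \<integral>\<^sup>+ r. ennreal ((g n r)\<^sup>2) \<partial>lborel) \<longlonglongrightarrow> 0"
  proof (rule tendsto_sandwich[OF _ _ tendsto_const hs])
    have "ennreal ((g n r)\<^sup>2) \<le> hs_norm_sq ((\<Phi> r - elementary_fun (E n) r) o\<^sub>L R) * indicator {0..t} r" for n r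
    proof (cases "r \<in> {0..t}")
      case True
      then show ?thesis
        using norm_le_hs_norm_sq by (simp add: g_def \<Psi>_def restrict_op_def)
    next
      case False
      then show ?thesis
        using elementary_fun_outside[OF E False] by (simp add: g_def \<Psi>_def restrict_op_def)
    qed
    then show "\<forall>\<^sub>F n in sequentially. (\<integral>\<^sup>+ r. ennreal ((g n r)\<^sup>2) \<partial>lborel) \<le>
        (\<integral>\<^sup>+ r\<in>{0..t}. hs_norm_sq ((\<Phi> r - elementary_fun (E n) r) o\<^sub>L R) \<partial>lborel)"
      by (intro always_eventually allI nn_integral_mono)
  qed simp
  show thesis
  proof (rule that)
    show "elementary_on t (E n)" for n
      by (rule E)
    show "(\<lambda>r. restrict_op t \<Phi> r u) \<in> borel_measurable lborel" for u
      using meas by (simp add: \<Psi>_def)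
    show "L2_limit lborel (\<lambda>n r. norm (elementary_fun (E n) r o\<^sub>L R)) (\<lambda>r. norm (restrict_op t \<Phi> r o\<^sub>L R))"
      unfolding \<Psi>_def[symmetric]
    proof (rule L2_limitI[where g = g and C = 1])
      show "(\<lambda>r. norm (\<Psi> r o\<^sub>L R)) \<in> borel_measurable lborel"
        by (intro measurable_norm_blinfun) (simp only: blinfun_apply_blinfun_compose meas)
      show "norm (norm (\<Psi> r o\<^sub>L R) - norm (elementary_fun (E n) r o\<^sub>L R)) \<le> 1 * g n r" for n r
        using norm_triangle_ineq3[of "\<Psi> r o\<^sub>L R" "elementary_fun (E n) r o\<^sub>L R"]
        by (simp add: g_def bounded_bilinear.diff_left[OF bounded_bilinear_blinfun_compose])
    qed (fact square_integrable_elementary_fun g_meas g_lim)+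
    show "L2_limit lborel (\<lambda>n r. R (adjoint (elementary_fun (E n) r) y)) (\<lambda>r. R (adjoint (restrict_op t \<Phi> r) y))" for y
      unfolding \<Psi>_def[symmetric]
    proof (rule L2_limitI[where g = g and C = "norm y"])
      show "square_integrable lborel (\<lambda>r. R (adjoint (elementary_fun (E n) r) y))" for n
      proof (rule square_integrable_bound[OF square_integrable_scaleR[OF square_integrable_elementary_fun]])
        show "(\<lambda>r. R (adjoint (elementary_fun (E n) r) y)) \<in> borel_measurable lborel"
          by (intro measurable_blinfun_apply_const measurable_adjoint elementary_fun_measurable)
        show "norm (R (adjoint (elementary_fun (E n) r) y)) \<le> norm (norm y *\<^sub>R norm (elementary_fun (E n) r o\<^sub>L R))" for r
          using norm_root_adjoint_le[OF R_self_adjoint] by simp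
      qed
      show "(\<lambda>r. R (adjoint (\<Psi> r) y)) \<in> borel_measurable lborel"
        by (intro measurable_blinfun_apply_const measurable_adjoint meas)
      show "norm (R (adjoint (\<Psi> r) y) - R (adjoint (elementary_fun (E n) r) y)) \<le> norm y * g n r" for n r
        using norm_root_adjoint_le[OF R_self_adjoint, of "\<Psi> r - elementary_fun (E n) r" y]
        by (simp add: g_def adjoint_blinfun_simps blinfun.bilinear_simps)
    qed (fact g_meas g_lim)+
    show "L2_limit M (\<lambda>n \<omega>. elementary_integral W (E n) \<omega> \<bullet> y) (\<lambda>\<omega>. I \<omega> \<bullet> y)" for y
    proof (rule L2_limitI[where g = "\<lambda>n \<omega>. norm (I \<omega> - elementary_integral W (E n) \<omega>)" and C = "norm y"])
      show "norm (I \<omega> \<bullet> y - elementary_integral W (E n) \<omega> \<bullet> y)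
          \<le> norm y * norm (I \<omega> - elementary_integral W (E n) \<omega>)" for n \<omega>
        using Cauchy_Schwarz_ineq2[of "I \<omega> - elementary_integral W (E n) \<omega>" y]
        by (simp add: inner_diff_left mult.commute)
      show "square_integrable M (\<lambda>\<omega>. elementary_integral W (E n) \<omega> \<bullet> y)" for n
        by (rule square_integrable_elementary_integral[OF E])
    qed (use ms in measurable)
  qed
qed

text \<open>
  Elementary integrals are centred, and \<open>L\<^sup>2\<close> limits preserve this by pairing with the constant 1.
  A Bochner integral of a nonintegrable function has the default value 0.
\<close>

lemma stoch_integral_mean_zero:
  assumes "stoch_integral M Q W t \<Phi> I"
  shows "integral\<^sup>L M I = 0"
proof (cases "integrable M I")
  case True
  have "integral\<^sup>L M I \<bullet> y = 0" for y
  proof -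
    obtain E where E: "\<And>n. elementary_on t (E n)"
      and lim: "L2_limit M (\<lambda>n \<omega>. elementary_integral W (E n) \<omega> \<bullet> y) (\<lambda>\<omega>. I \<omega> \<bullet> y)"
      using stoch_integral_approximation[OF assms] by metis
    have one: "L2_limit M (\<lambda>n \<omega>. 1) (\<lambda>\<omega>. 1 :: real)"
      by (simp add: L2_limit_def square_integrable_def)
    have "(\<lambda>n. 0) \<longlonglongrightarrow> (\<integral>\<omega>. I \<omega> \<bullet> y \<partial>M)"
      using L2_limit_inner[OF lim one] elementary_integral_mean_zero[OF E] by simp
    then show ?thesis
      using True LIMSEQ_unique[OF _ tendsto_const] by (simp add: LIMSEQ_const_iff)
  qed
  then show ?thesis
    by (metis inner_eq_zero_iff)
qed (rule not_integrable_integral_eq)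

text \<open>
  The polarised isometry passes to the limit on both sides.  Since \<open>R R = Q\<close>, the kernel
  \<open>\<Psi> Q \<Phi>\<^sup>* x\<close> factors as \<open>(\<Psi> R) (R \<Phi>\<^sup>* x)\<close>, which yields an integrable bound linear in \<open>\<parallel>x\<parallel>\<close>: hence
  integrability and boundedness of the resulting operator.
\<close>

lemma stoch_integral_covariance:
  assumes I: "stoch_integral M Q W s \<Phi> I" and J: "stoch_integral M Q W t \<Psi> J"
  defines "k \<equiv> \<lambda>x r. restrict_op t \<Psi> r (Q (adjoint (restrict_op s \<Phi> r) x))"
  shows "integrable lborel (k x)"
    "bounded_linear (\<lambda>x. \<integral>r. k x r \<partial>lborel)"
    "(\<integral>\<omega>. (I \<omega> \<bullet> x) * (J \<omega> \<bullet> y) \<partial>M) = (\<integral>r. k x r \<partial>lborel) \<bullet> y"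
proof -
  define \<Phi>0 \<Psi>0 where "\<Phi>0 = restrict_op s \<Phi>" and "\<Psi>0 = restrict_op t \<Psi>"
  obtain E where E: "\<And>n. elementary_on s (E n)"
    and E1: "L2_limit lborel (\<lambda>n r. norm (elementary_fun (E n) r o\<^sub>L R)) (\<lambda>r. norm (\<Phi>0 r o\<^sub>L R))"
    and E2: "\<And>y. L2_limit lborel (\<lambda>n r. R (adjoint (elementary_fun (E n) r) y)) (\<lambda>r. R (adjoint (\<Phi>0 r) y))"
    and E3: "\<And>y. L2_limit M (\<lambda>n \<omega>. elementary_integral W (E n) \<omega> \<bullet> y) (\<lambda>\<omega>. I \<omega> \<bullet> y)"
    and \<Phi>m: "\<And>u. (\<lambda>r. \<Phi>0 r u) \<in> borel_measurable lborel"
    using stoch_integral_approximation[OF I] unfolding \<Phi>0_def by metis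
  obtain G where G: "\<And>n. elementary_on t (G n)"
    and G1: "L2_limit lborel (\<lambda>n r. norm (elementary_fun (G n) r o\<^sub>L R)) (\<lambda>r. norm (\<Psi>0 r o\<^sub>L R))"
    and G2: "\<And>y. L2_limit lborel (\<lambda>n r. R (adjoint (elementary_fun (G n) r) y)) (\<lambda>r. R (adjoint (\<Psi>0 r) y))"
    and G3: "\<And>y. L2_limit M (\<lambda>n \<omega>. elementary_integral W (G n) \<omega> \<bullet> y) (\<lambda>\<omega>. J \<omega> \<bullet> y)"
    and \<Psi>m: "\<And>u. (\<lambda>r. \<Psi>0 r u) \<in> borel_measurable lborel"
    using stoch_integral_approximation[OF J] unfolding \<Psi>0_def by metis
  have k: "k x r = \<Psi>0 r (Q (adjoint (\<Phi>0 r) x))" for x r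
    by (simp add: k_def \<Phi>0_def \<Psi>0_def)
  define w where "w r = norm (\<Psi>0 r o\<^sub>L R) * norm (\<Phi>0 r o\<^sub>L R)" for r
  have w: "integrable lborel w"
    using square_integrable_inner[OF G1[THEN L2_limit_square_integrable] E1[THEN L2_limit_square_integrable]]
    by (simp add: w_def[abs_def])
  have k_le: "norm (k x r) \<le> w r * norm x" for x r
  proof -
    have "norm (k x r) = norm ((\<Psi>0 r o\<^sub>L R) (R (adjoint (\<Phi>0 r) x)))"
      by (simp add: k R_R)
    also have "\<dots> \<le> norm (\<Psi>0 r o\<^sub>L R) * norm (R (adjoint (\<Phi>0 r) x))"
      by (rule norm_blinfun)
    also have "\<dots> \<le> norm (\<Psi>0 r o\<^sub>L R) * (norm x * norm (\<Phi>0 r o\<^sub>L R))"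
      by (intro mult_left_mono norm_root_adjoint_le R_self_adjoint) simp
    finally show ?thesis
      by (simp add: w_def mult_ac)
  qed
  have int: "integrable lborel (k x)" for x
  proof (rule Bochner_Integration.integrable_bound)
    show "integrable lborel (\<lambda>r. w r * norm x)"
      using w by simp
    show "k x \<in> borel_measurable lborel"
      unfolding k[abs_def]
      by (rule measurable_blinfun_apply[OF \<Psi>m])
        (intro measurable_blinfun_apply_const measurable_adjoint \<Phi>m)
    show "AE r in lborel. norm (k x r) \<le> norm (w r * norm x)"
      using k_le by (intro AE_I2) (auto intro: order_trans[OF _ abs_ge_self])
  qed
  show "integrable lborel (k x)"
    by (rule int)
  show "bounded_linear (\<lambda>x. \<integral>r. k x r \<partial>lborel)"
  proof (rule bounded_linear_intro)
    show "(\<integral>r. k (x + y) r \<partial>lborel) = (\<integral>r. k x r \<partial>lborel) + (\<integral>r. k y r \<partial>lborel)" for x y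
    proof -
      have "k (x + y) = (\<lambda>r. k x r + k y r)"
        by (simp add: k fun_eq_iff adjoint_blinfun_simps blinfun.bilinear_simps)
      then show ?thesis
        using int by simp
    qed
    show "(\<integral>r. k (c *\<^sub>R x) r \<partial>lborel) = c *\<^sub>R (\<integral>r. k x r \<partial>lborel)" for c x
    proof -
      have "k (c *\<^sub>R x) = (\<lambda>r. c *\<^sub>R k x r)"
        by (simp add: k fun_eq_iff adjoint_blinfun_simps blinfun.bilinear_simps)
      then show ?thesis
        by simp
    qed
    show "norm (\<integral>r. k x r \<partial>lborel) \<le> norm x * (\<integral>r. w r \<partial>lborel)" for x
    proof -
      have "norm (\<integral>r. k x r \<partial>lborel) \<le> (\<integral>r. w r * norm x \<partial>lborel)"
        using w k_le int by (intro order_trans[OF integral_norm_bound integral_mono]) auto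
      then show ?thesis
        by (simp add: mult.commute)
    qed
  qed
  have "(\<lambda>n. \<integral>\<omega>. (elementary_integral W (E n) \<omega> \<bullet> x) * (elementary_integral W (G n) \<omega> \<bullet> y) \<partial>M)
      \<longlonglongrightarrow> (\<integral>\<omega>. (I \<omega> \<bullet> x) * (J \<omega> \<bullet> y) \<partial>M)"
    using L2_limit_inner[OF E3 G3] by simp
  moreover have "(\<integral>\<omega>. (elementary_integral W (E n) \<omega> \<bullet> x) * (elementary_integral W (G n) \<omega> \<bullet> y) \<partial>M)
      = (\<integral>r. R (adjoint (elementary_fun (E n) r) x) \<bullet> R (adjoint (elementary_fun (G n) r) y) \<partial>lborel)" for n
    by (simp only: elementary_covariance(2)[OF E G] R_inner)
  moreover have "(\<lambda>n. \<integral>r. R (adjoint (elementary_fun (E n) r) x) \<bullet> R (adjoint (elementary_fun (G n) r) y) \<partial>lborel)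
      \<longlonglongrightarrow> (\<integral>r. R (adjoint (\<Phi>0 r) x) \<bullet> R (adjoint (\<Psi>0 r) y) \<partial>lborel)"
    by (rule L2_limit_inner[OF E2 G2])
  ultimately have "(\<integral>\<omega>. (I \<omega> \<bullet> x) * (J \<omega> \<bullet> y) \<partial>M)
      = (\<integral>r. R (adjoint (\<Phi>0 r) x) \<bullet> R (adjoint (\<Psi>0 r) y) \<partial>lborel)"
    by (simp add: LIMSEQ_unique)
  also have "\<dots> = (\<integral>r. k x r \<bullet> y \<partial>lborel)"
    by (simp only: k R_inner adjoint_works_Hilbert)
  also have "\<dots> = (\<integral>r. k x r \<partial>lborel) \<bullet> y"
    using int by simp
  finally show "(\<integral>\<omega>. (I \<omega> \<bullet> x) * (J \<omega> \<bullet> y) \<partial>M) = (\<integral>r. k x r \<partial>lborel) \<bullet> y" .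
qed

end

section \<open>The covariance operators of the mild solution\<close>

text \<open>
  Operators are determined by their bilinear forms, so any bounded operator with the right form is
  the one described.
\<close>

lemma covariance_op_eqI:
  assumes "bounded_linear C"
    and "\<And>x y. C x \<bullet> y = (\<integral>\<omega>. ((X \<omega> - integral\<^sup>L M X) \<bullet> x) * ((Y \<omega> - integral\<^sup>L M Y) \<bullet> y) \<partial>M)"
  shows "covariance_op M X Y x = C x"
proof -
  have C: "blinfun_apply (Blinfun C) = C"
    by (rule bounded_linear_Blinfun_apply) fact
  have "covariance_op M X Y = Blinfun C"
    unfolding covariance_op_def
  proof (rule the_equality)
    fix C'
    assume C': "\<forall>x y. blinfun_apply C' x \<bullet> y =
      (\<integral>\<omega>. ((X \<omega> - integral\<^sup>L M X) \<bullet> x) * ((Y \<omega> - integral\<^sup>L M Y) \<bullet> y) \<partial>M)"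
    have "C' x = C x" for x
      by (rule vector_eq_rdot[THEN iffD1]) (simp add: C' assms(2))
    then show "C' = Blinfun C"
      by (intro blinfun_eqI) (simp add: C)
  qed (simp add: C assms(2))
  then show ?thesis
    by (simp add: C)
qed

lemma (in complete_measure) measurable_AE_eq:
  assumes f: "f \<in> measurable M N" and g: "\<And>x. x \<in> space M \<Longrightarrow> g x \<in> space N"
    and ae: "AE x in M. g x = f x"
  shows "g \<in> measurable M N"
proof (rule measurableI)
  fix A assume A: "A \<in> sets N"
  show "g -` A \<inter> space M \<in> sets M"
  proof (rule in_sets_AE)
    show "AE x in M. x \<in> f -` A \<inter> space M \<longleftrightarrow> x \<in> g -` A \<inter> space M"
      using ae by eventually_elim auto
    show "f -` A \<inter> space M \<in> sets M"
      using f A by (rule measurable_sets)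
  qed simp
qed (rule g)

theorem proposition4p1:
  fixes M :: "'w measure"
    and F :: "real \<Rightarrow> 'w measure"
    and Q :: "'h::{real_inner, banach, second_countable_topology} \<Rightarrow>\<^sub>L 'h"
    and W :: "real \<Rightarrow> 'h \<Rightarrow> 'w \<Rightarrow> real"
    and D :: "'h set"
    and A :: "'h \<Rightarrow> 'h"
    and S :: "real \<Rightarrow> ('h \<Rightarrow>\<^sub>L 'h)"
    and T \<gamma> :: real
    and Z :: "real \<Rightarrow> 'w \<Rightarrow> 'h"
  assumes "prob_space M" and "complete_measure M"
    and "normal_filtration M F"
    and "self_adjoint_op Q" and "strictly_positive_op Q"
    and "cylindrical_wiener M F Q W"
    and "T > 0"
    and "linear_op_on D A"
    and "c0_semigroup S" and "generates D (\<lambda>x. - A x) S"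
    and "\<gamma> > 0"
    and "\<exists>\<delta>\<in>{0..<\<gamma>}.
           (\<integral>\<^sup>+ t\<in>{0..T}. hs_norm_sq (t powr (\<gamma> - 1 - \<delta>) *\<^sub>R (S t o\<^sub>L sqrt_op Q)) \<partial>lborel) < \<infinity>"
    and "mild_solution M F Q W S \<gamma> T Z"
  shows "\<forall>s\<in>{0..T}. \<forall>t\<in>{0..T}. \<forall>x.
           set_integrable lborel {0..min s t}
             (\<lambda>r. ((s - r) * (t - r)) powr (\<gamma> - 1) *\<^sub>R S (t - r) (Q (adjoint (S (s - r)) x))) \<and>
           covariance_op M (Z s) (Z t) x =
             (1 / (Gamma \<gamma>)\<^sup>2) *\<^sub>R
               (LINT r:{0..min s t}|lborel.
                  ((s - r) * (t - r)) powr (\<gamma> - 1) *\<^sub>R S (t - r) (Q (adjoint (S (s - r)) x)))"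
proof (intro ballI allI)
  fix s t x
  assume s: "s \<in> {0..T}" and t: "t \<in> {0..T}"
  interpret coercive_wiener_process M F Q W
    by (intro coercive_wiener_process.intro wiener_process.intro assms coercive_wiener_process_axioms.intro wiener_process_axioms.intro)
  interpret complete_measure M
    by fact
  define \<Phi> where "\<Phi> t r = (t - r) powr (\<gamma> - 1) *\<^sub>R S (t - r)" for t r
  define c where "c = 1 / Gamma \<gamma>"
  have version: "\<exists>I. stoch_integral M Q W t (\<Phi> t) I \<and> (AE \<omega> in M. Z t \<omega> = c *\<^sub>R I \<omega>)" if "t \<in> {0..T}" for t
    using assms(13) that by (simp add: mild_solution_def \<Phi>_def[abs_def] c_def)
  obtain I where I: "stoch_integral M Q W s (\<Phi> s) I" and ZI: "AE \<omega> in M. Z s \<omega> = c *\<^sub>R I \<omega>"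
    using version[OF s] by blast
  obtain J where J: "stoch_integral M Q W t (\<Phi> t) J" and ZJ: "AE \<omega> in M. Z t \<omega> = c *\<^sub>R J \<omega>"
    using version[OF t] by blast
  have [measurable]: "I \<in> borel_measurable M" "J \<in> borel_measurable M"
    using I J by (simp_all add: stoch_integral_def)
  \<comment> \<open>completeness of \<open>M\<close> makes a random variable measurable if one of its versions is\<close>
  have [measurable]: "Z s \<in> borel_measurable M"
    by (rule measurable_AE_eq[OF _ _ ZI]) simp_all
  have [measurable]: "Z t \<in> borel_measurable M"
    by (rule measurable_AE_eq[OF _ _ ZJ]) simp_all
  have mean: "integral\<^sup>L M (Z s) = 0" "integral\<^sup>L M (Z t) = 0"
    using integral_cong_AE[OF _ _ ZI] integral_cong_AE[OF _ _ ZJ]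
      stoch_integral_mean_zero[OF I] stoch_integral_mean_zero[OF J] by simp_all
  define k where "k x r = restrict_op t (\<Phi> t) r (Q (adjoint (restrict_op s (\<Phi> s) r) x))" for x r
  note cov = stoch_integral_covariance[OF I J, folded k_def]
  \<comment> \<open>on \<open>[0, min s t]\<close> both \<open>s - r\<close> and \<open>t - r\<close> are nonnegative, so the power of the product splits\<close>
  have k_eq: "indicat_real {0..min s t} r *\<^sub>R
      (((s - r) * (t - r)) powr (\<gamma> - 1) *\<^sub>R S (t - r) (Q (adjoint (S (s - r)) x))) = k x r" for x r
    by (auto simp: k_def restrict_op_def \<Phi>_def indicator_def adjoint_blinfun_simps
        blinfun.bilinear_simps powr_mult mult.commute)
  have "covariance_op M (Z s) (Z t) x = c\<^sup>2 *\<^sub>R (\<integral>r. k x r \<partial>lborel)"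
  proof (rule covariance_op_eqI)
    show "bounded_linear (\<lambda>x. c\<^sup>2 *\<^sub>R (\<integral>r. k x r \<partial>lborel))"
      using bounded_linear_compose[OF bounded_linear_scaleR_right cov(2)] .
    fix x y
    have "(\<integral>\<omega>. ((Z s \<omega> - integral\<^sup>L M (Z s)) \<bullet> x) * ((Z t \<omega> - integral\<^sup>L M (Z t)) \<bullet> y) \<partial>M)
        = (\<integral>\<omega>. c\<^sup>2 * ((I \<omega> \<bullet> x) * (J \<omega> \<bullet> y)) \<partial>M)"
    proof (rule integral_cong_AE)
      show "AE \<omega> in M. ((Z s \<omega> - integral\<^sup>L M (Z s)) \<bullet> x) * ((Z t \<omega> - integral\<^sup>L M (Z t)) \<bullet> y)
          = c\<^sup>2 * ((I \<omega> \<bullet> x) * (J \<omega> \<bullet> y))"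
        using ZI ZJ by eventually_elim (simp add: mean power2_eq_square)
    qed measurable
    also have "\<dots> = c\<^sup>2 *\<^sub>R (\<integral>r. k x r \<partial>lborel) \<bullet> y"
      by (simp add: cov(3))
    finally show "c\<^sup>2 *\<^sub>R (\<integral>r. k x r \<partial>lborel) \<bullet> y =
        (\<integral>\<omega>. ((Z s \<omega> - integral\<^sup>L M (Z s)) \<bullet> x) * ((Z t \<omega> - integral\<^sup>L M (Z t)) \<bullet> y) \<partial>M)"
      by simp
  qed
  then show "set_integrable lborel {0..min s t}
             (\<lambda>r. ((s - r) * (t - r)) powr (\<gamma> - 1) *\<^sub>R S (t - r) (Q (adjoint (S (s - r)) x))) \<and>
           covariance_op M (Z s) (Z t) x =
             (1 / (Gamma \<gamma>)\<^sup>2) *\<^sub>R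
               (LINT r:{0..min s t}|lborel.
                  ((s - r) * (t - r)) powr (\<gamma> - 1) *\<^sub>R S (t - r) (Q (adjoint (S (s - r)) x)))"
    unfolding set_integrable_def set_lebesgue_integral_def k_eq
    using cov(1)[of x] by (simp add: c_def power_divide)
qed

end
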